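(* Let $\pi\subset\mathrm{Iso}(\mathbb R^n)$ be a Bieberbach group, $M_\pi=\mathbb R^n/\pi$ the associated closed flat manifold, and $W\subset\mathbb R^n$ an $H_\pi$-invariant and $L_\pi$-generated subspace. The following are equivalent: (i) $M_\pi/\mathcal F_W$ is a smooth closed flat manifold, and the projection $M_\pi\to M_\pi/\mathcal F_W$ is a fiber bundle; (ii) all leaves of the subspace foliation $\mathcal F_W$ are isometric; (iii) the subspace foliation $\mathcal F_W$ contains no exceptional leaves; (iv) $P_{W^\perp}(v)\notin\mathrm{Im}(A-\mathrm{Id})$ for all $(A,v)\in\pi$ with $A|_{W^\perp}\neq\mathrm{Id}$.
   Context: $\mathrm{Iso}(\mathbb R^n)=\mathrm O(n)\ltimes\mathbb R^n$, and $(A,v)$ acts by $x\mapsto Ax+v$. A crystallographic group is a discrete subgroup of $\mathrm{Iso}(\mathbb R^n)$ such that some compact subset of $\mathbb R^n$ meets every orbit; a Bieberbach group is a torsion-free crystallographic group. For a Bieberbach group $\pi$: $L_\pi=\{v\in\mathbb R^n:(\mathrm{Id},v)\in\pi\}$ is a lattice in $\mathbb R^n$ and $H_\pi=\{A:(A,v)\in\pi\text{ for some }v\}\subset\mathrm O(n)$ is a finite group preserving $L_\pi$. $M_\pi=\mathbb R^n/\pi$ carries the flat metric for which the quotient map $P_\pi\colon\mathbb R^n\to M_\pi$ is a Riemannian covering. $W$ is $L_\pi$-generated if $W=\mathrm{span}_{\mathbb R}(W\cap L_\pi)$. For an $H_\pi$-invariant subspace $W$, the subspace foliation $\mathcal F_W$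 of $M_\pi$ has leaves $\mathcal F_W(u)=P_\pi(W+u)$, $u\in W^\perp$ (one also writes $\mathcal F_W(u)=P_\pi(W+u)$ for any $u\in\mathbb R^n$). When $W$ is also $L_\pi$-generated, the leaves are compact, totally geodesic, equidistant submanifolds, each a closed flat manifold with the induced metric. $P_{W^\perp}\colon\mathbb R^n\to W^\perp$ is the orthogonal projection. The leaf space $M_\pi/\mathcal F_W$, with the metric given by the distance between leaves, is the flat orbifold $W^\perp/\pi^\perp$, where $\pi^\perp\subset\mathrm{Iso}(W^\perp)$ is the crystallographic group $\{(A|_{W^\perp},P_{W^\perp}(v)):(A,v)\in\pi\}$; it is a smooth closed flat manifold if it has no singular points as an orbifold, i.e., if every point of $W^\perp$ has trivial stabilizer in $\pi^\perp$. For $u\in\mathbb R^n$ let $G_W(u)=\{(A,v)\in\pi:(A-\mathrm{Id})u+v\in W\}$. The leaf $\mathcal F_W(u)$ is exceptional if there exists $u'\in\mathbb R^n$ with $G_W(u)\not\subset G_W(u')$. *)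

theory Defs
  imports "HOL-Analysis.Analysis" "HOL-Algebra.Group"
begin

section \<open>Bieberbach groups\<close>

type_synonym 'n rigid = "(real^'n^'n) \<times> (real^'n)"

fun act :: "'n::finite rigid \<Rightarrow> real^'n \<Rightarrow> real^'n" where
  "act (A, v) x = A *v x + v"

definition Iso :: "'n::finite rigid monoid" where
  "Iso = \<lparr>carrier = {(A, v). orthogonal_matrix A},
          mult = (\<lambda>(A, v) (B, w). (A ** B, A *v w + v)),
          one = (mat 1, 0)\<rparr>"

lemma act_mult: "act (g \<otimes>\<^bsub>Iso\<^esub> h) x = act g (act h x)"
  by (cases g; cases h)
    (simp add: Iso_def matrix_vector_mul_assoc matrix_vector_right_distrib add.assoc)

lemma group_Iso: "group (Iso :: 'n::finite rigid monoid)"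
proof (rule groupI)
  fix g :: "'n rigid" assume g: "g \<in> carrier Iso"
  obtain A v where gv: "g = (A, v)" by (cases g)
  have A: "orthogonal_matrix A" using g gv by (simp add: Iso_def)
  show "\<exists>h\<in>carrier Iso. h \<otimes>\<^bsub>Iso\<^esub> g = \<one>\<^bsub>Iso\<^esub>"
  proof
    show "(transpose A, - (transpose A *v v)) \<in> carrier Iso"
      using A by (simp add: Iso_def orthogonal_matrix_transpose)
    show "(transpose A, - (transpose A *v v)) \<otimes>\<^bsub>Iso\<^esub> g = \<one>\<^bsub>Iso\<^esub>"
      using A by (simp add: Iso_def gv orthogonal_matrix)
  qed
qed (auto simp: Iso_def orthogonal_matrix_mul orthogonal_matrix_id matrix_mul_assoc
      matrix_vector_mul_assoc matrix_vector_right_distrib add.assoc)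

text \<open>\<^const>\<open>discrete\<close> refers to the topology of
  \<open>O(n) \<times> \<real>\<^sup>n\<close> as a subspace of matrices times vectors.\<close>

definition crystallographic :: "'n::finite rigid set \<Rightarrow> bool" where
  "crystallographic \<pi> \<longleftrightarrow> subgroup \<pi> Iso \<and> discrete \<pi> \<and>
     (\<exists>K. compact K \<and> (\<forall>x. \<exists>g\<in>\<pi>. act g x \<in> K))"

definition torsion_free :: "('a, 'b) monoid_scheme \<Rightarrow> 'a set \<Rightarrow> bool" where
  "torsion_free G H \<longleftrightarrow>
     (\<forall>g\<in>H. \<forall>k::nat. 0 < k \<and> g [^]\<^bsub>G\<^esub> k = \<one>\<^bsub>G\<^esub> \<longrightarrow> g = \<one>\<^bsub>G\<^esub>)"

definition bieberbach :: "'n::finite rigid set \<Rightarrow> bool" where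
  "bieberbach \<pi> \<longleftrightarrow> crystallographic \<pi> \<and> torsion_free Iso \<pi>"

definition lattice_of :: "'n::finite rigid set \<Rightarrow> (real^'n) set" where
  "lattice_of \<pi> = {v. (mat 1, v) \<in> \<pi>}"

definition holonomy :: "'n::finite rigid set \<Rightarrow> (real^'n^'n) set" where
  "holonomy \<pi> = {A. \<exists>v. (A, v) \<in> \<pi>}"

definition invariant_under :: "(real^'n^'n) set \<Rightarrow> (real^'n::finite) set \<Rightarrow> bool" where
  "invariant_under H W \<longleftrightarrow> (\<forall>A\<in>H. \<forall>w\<in>W. A *v w \<in> W)"

definition generated_by_lattice :: "(real^'n::finite) set \<Rightarrow> (real^'n) set \<Rightarrow> bool" where
  "generated_by_lattice L W \<longleftrightarrow> W = span (W \<inter> L)"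

definition orth_proj :: "'a::euclidean_space set \<Rightarrow> 'a \<Rightarrow> 'a" where
  "orth_proj V x = (THE y. y \<in> V \<and> x - y \<in> V\<^sup>\<bottom>)"


section \<open>Smooth maps and fiber bundles\<close>

text \<open>\<open>Ck_on k S f\<close> is meaningful for open \<open>S\<close>.\<close>

primrec Ck_on :: "nat \<Rightarrow> 'a::euclidean_space set \<Rightarrow> ('a \<Rightarrow> 'b::euclidean_space) \<Rightarrow> bool" where
  "Ck_on 0 S f \<longleftrightarrow> continuous_on S f"
| "Ck_on (Suc k) S f \<longleftrightarrow> (\<forall>x\<in>S. f differentiable (at x)) \<and>
     (\<forall>v. Ck_on k S (\<lambda>x. frechet_derivative f (at x) v))"

definition smooth_on :: "'a::euclidean_space set \<Rightarrow> ('a \<Rightarrow> 'b::euclidean_space) \<Rightarrow> bool" where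
  "smooth_on S f \<longleftrightarrow> (\<forall>k. Ck_on k S f)"

text \<open>A manifold \<open>X\<close> is presented by a surjective submersion \<open>q\<close> from a Euclidean space onto
  \<open>X = range q\<close> (for instance its universal covering).  It carries the quotient topology, so
  \<open>U \<subseteq> X\<close> is open iff \<open>q -` U\<close> is open, and the product of manifolds presented by \<open>b\<close> and \<open>r\<close>
  is presented by \<open>map_prod b r\<close>.  Because submersions have smooth local sections, a map \<open>h\<close>
  from an open \<open>D \<subseteq> range q\<close> to \<open>range r\<close> is smooth iff near every point of \<open>q -` D\<close> it is
  covered by a smooth map between the Euclidean spaces.\<close>

definition smooth_map ::
    "('a::euclidean_space \<Rightarrow> 'x) \<Rightarrow> ('b::euclidean_space \<Rightarrow> 'y) \<Rightarrow> 'x set \<Rightarrow> ('x \<Rightarrow> 'y) \<Rightarrow> bool" where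
  "smooth_map q r D h \<longleftrightarrow>
     (\<forall>x. q x \<in> D \<longrightarrow> (\<exists>V g. open V \<and> x \<in> V \<and> smooth_on V g \<and> (\<forall>y\<in>V. r (g y) = h (q y))))"

definition diffeo ::
    "('a::euclidean_space \<Rightarrow> 'x) \<Rightarrow> ('b::euclidean_space \<Rightarrow> 'y) \<Rightarrow> 'x set \<Rightarrow> 'y set \<Rightarrow> ('x \<Rightarrow> 'y) \<Rightarrow> bool"
  where
  "diffeo q r D E h \<longleftrightarrow>
     bij_betw h D E \<and> smooth_map q r D h \<and> smooth_map r q E (inv_into D h)"

definition smooth_fiber_bundle ::
    "('a::euclidean_space \<Rightarrow> 'x) \<Rightarrow> ('b::euclidean_space \<Rightarrow> 'y) \<Rightarrow> ('c::euclidean_space \<Rightarrow> 'z)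
       \<Rightarrow> ('x \<Rightarrow> 'y) \<Rightarrow> bool" where
  "smooth_fiber_bundle q b r p \<longleftrightarrow>
     p ` range q = range b \<and> smooth_map q b (range q) p \<and>
     (\<forall>y\<in>range b. \<exists>U \<Phi>. y \<in> U \<and> U \<subseteq> range b \<and> open (b -` U) \<and>
        diffeo q (map_prod b r) {m \<in> range q. p m \<in> U} (U \<times> range r) \<Phi> \<and>
        (\<forall>m\<in>range q. p m \<in> U \<longrightarrow> fst (\<Phi> m) = p m))"


section \<open>The flat manifold and the subspace foliation\<close>

text \<open>Points of \<open>M\<^sub>\<pi>\<close> are the orbits of \<open>\<pi>\<close>, and \<open>proj_M \<pi>\<close> is the covering
  \<open>\<real>\<^sup>n \<rightarrow> M\<^sub>\<pi>\<close>.  Leaves are sets of points of \<open>M\<^sub>\<pi>\<close>.\<close>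

definition proj_M :: "'n::finite rigid set \<Rightarrow> real^'n \<Rightarrow> (real^'n) set" where
  "proj_M \<pi> x = (\<lambda>g. act g x) ` \<pi>"

definition leaf :: "'n::finite rigid set \<Rightarrow> (real^'n) set \<Rightarrow> real^'n \<Rightarrow> (real^'n) set set" where
  "leaf \<pi> W u = proj_M \<pi> ` ((\<lambda>w. w + u) ` W)"

definition leaf_space :: "'n::finite rigid set \<Rightarrow> (real^'n) set \<Rightarrow> (real^'n) set set set" where
  "leaf_space \<pi> W = range (leaf \<pi> W)"

definition leaf_proj ::
    "'n::finite rigid set \<Rightarrow> (real^'n) set \<Rightarrow> (real^'n) set \<Rightarrow> (real^'n) set set" where
  "leaf_proj \<pi> W m = (THE F. F \<in> leaf_space \<pi> W \<and> m \<in> F)"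


subsection \<open>Exceptional leaves\<close>

definition G_W :: "'n::finite rigid set \<Rightarrow> (real^'n) set \<Rightarrow> real^'n \<Rightarrow> 'n rigid set" where
  "G_W \<pi> W u = {(A, v). (A, v) \<in> \<pi> \<and> (A - mat 1) *v u + v \<in> W}"

definition exceptional :: "'n::finite rigid set \<Rightarrow> (real^'n) set \<Rightarrow> real^'n \<Rightarrow> bool" where
  "exceptional \<pi> W u \<longleftrightarrow> (\<exists>u'. \<not> G_W \<pi> W u \<subseteq> G_W \<pi> W u')"


subsection \<open>Smoothness of the leaf space\<close>

text \<open>Elements of \<open>\<pi>\<^sup>\<bottom>\<close>, i.e. pairs \<open>(A|\<^bsub>W\<^sup>\<bottom>\<^esub>, P\<^bsub>W\<^sup>\<bottom>\<^esub> v)\<close>, are represented by the isometries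
  of \<open>W\<^sup>\<bottom>\<close> they define.\<close>

definition perp_group ::
    "'n::finite rigid set \<Rightarrow> (real^'n) set \<Rightarrow> (real^'n \<Rightarrow> real^'n) set" where
  "perp_group \<pi> W = {restrict (\<lambda>x. A *v x + orth_proj (W\<^sup>\<bottom>) v) (W\<^sup>\<bottom>) | A v. (A, v) \<in> \<pi>}"

text \<open>\<open>M\<^sub>\<pi>/\<F>\<^sub>W\<close> is the flat orbifold \<open>W\<^sup>\<bottom>/\<pi>\<^sup>\<bottom>\<close>; it is a smooth closed flat manifold when no
  point of \<open>W\<^sup>\<bottom>\<close> has a nontrivial stabilizer.\<close>

definition leaf_space_smooth :: "'n::finite rigid set \<Rightarrow> (real^'n) set \<Rightarrow> bool" where
  "leaf_space_smooth \<pi> W \<longleftrightarrow>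
     (\<forall>x\<in>W\<^sup>\<bottom>. \<forall>g\<in>perp_group \<pi> W. g x = x \<longrightarrow> g = restrict id (W\<^sup>\<bottom>))"


subsection \<open>The fiber bundle condition\<close>

text \<open>\<open>leaf_cover \<pi> W u\<close> presents \<open>leaf \<pi> W u\<close>: it is the submersion \<open>\<real>\<^sup>n \<rightarrow> W + u\<close>,
  \<open>x \<mapsto> P\<^sub>W x + u\<close>, followed by the covering \<open>W + u \<rightarrow> leaf \<pi> W u\<close>.  Likewise \<open>leaf \<pi> W\<close>
  presents the leaf space, since the leaf through \<open>x\<close> corresponds to the \<open>\<pi>\<^sup>\<bottom>\<close>-orbit of
  \<open>P\<^bsub>W\<^sup>\<bottom>\<^esub> x\<close>.  The typical fiber of \<open>M\<^sub>\<pi> \<rightarrow> M\<^sub>\<pi>/\<F>\<^sub>W\<close> is diffeomorphic to a fiber, so there is no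
  loss in taking it to be a leaf.\<close>

definition leaf_cover ::
    "'n::finite rigid set \<Rightarrow> (real^'n) set \<Rightarrow> real^'n \<Rightarrow> real^'n \<Rightarrow> (real^'n) set" where
  "leaf_cover \<pi> W u x = proj_M \<pi> (orth_proj W x + u)"

definition leaf_bundle :: "'n::finite rigid set \<Rightarrow> (real^'n) set \<Rightarrow> bool" where
  "leaf_bundle \<pi> W \<longleftrightarrow>
     (\<exists>u. smooth_fiber_bundle (proj_M \<pi>) (leaf \<pi> W) (leaf_cover \<pi> W u) (leaf_proj \<pi> W))"


subsection \<open>Isometry of leaves\<close>

text \<open>The metric induced on \<open>leaf \<pi> W u\<close> makes \<open>W + u \<rightarrow> leaf \<pi> W u\<close> a Riemannian covering, so
  its pullback along \<open>leaf_cover \<pi> W u\<close> has norm \<open>\<parallel>P\<^sub>W \<xi>\<parallel>\<close>.  The diffeomorphism \<open>\<phi>\<close> therefore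
  preserves the Riemannian metrics iff its local smooth lifts \<open>g\<close> satisfy
  \<open>\<parallel>P\<^sub>W (Dg \<xi>)\<parallel> = \<parallel>P\<^sub>W \<xi>\<parallel>\<close>; this does not depend on the choice of the lift.\<close>

definition isometric_leaves ::
    "'n::finite rigid set \<Rightarrow> (real^'n) set \<Rightarrow> real^'n \<Rightarrow> real^'n \<Rightarrow> bool" where
  "isometric_leaves \<pi> W u u' \<longleftrightarrow>
     (\<exists>\<phi>. diffeo (leaf_cover \<pi> W u) (leaf_cover \<pi> W u') (leaf \<pi> W u) (leaf \<pi> W u') \<phi> \<and>
        (\<forall>x. \<exists>V g. open V \<and> x \<in> V \<and> smooth_on V g \<and>
           (\<forall>y\<in>V. leaf_cover \<pi> W u' (g y) = \<phi> (leaf_cover \<pi> W u y)) \<and>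
           (\<forall>y\<in>V. \<forall>\<xi>. norm (orth_proj W (frechet_derivative g (at y) \<xi>)) = norm (orth_proj W \<xi>))))"


end

theory Submission
  imports Defs
begin

text \<open>The group \<open>\<pi>\<close> acts on \<open>W\<^sup>\<bottom>\<close> properly discontinuously once it is taken modulo the lattice
  \<open>W \<inter> L\<^sub>\<pi>\<close>, and \<open>G\<^sub>W(u)\<close> is the stabilizer of the projection of \<open>u\<close> to \<open>W\<^sup>\<bottom>\<close>.  Without exceptional leaves every
  stabilizer acts trivially on \<open>W\<^sup>\<bottom>\<close>; then \<open>x \<mapsto> P\<^sub>W x\<close> descends on thin tubes around a leaf to a
  trivialization, and translations of \<open>W\<^sup>\<bottom>\<close> induce isometries between leaves.

  Conversely, let \<open>\<F>\<^sub>W(a)\<close> be exceptional.  A leaf \<open>\<F>\<^sub>W(c)\<close> with \<open>G\<^sub>W(c) \<subset> G\<^sub>W(a)\<close> strictly has at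
  each point \<open>x \<in> W\<close> fewer short geodesic loops (orbit points within distance \<open>R\<close> of \<open>x\<close>), for \<open>R\<close>
  large.  An isometry \<open>\<F>\<^sub>W(a) \<rightarrow> \<F>\<^sub>W(c)\<close> lifts to an injective 1-Lipschitz map of \<open>W\<close> that
  preserves orbits, so it cannot decrease the number of these loops: a contradiction at a point where the
  bounded count for \<open>\<F>\<^sub>W(c)\<close> is maximal.\<close>

section \<open>Orthogonal projections and affine maps\<close>

lemma orth_proj_decomp:
  fixes V :: "'a::euclidean_space set"
  assumes "subspace V"
  shows "\<exists>!y. y \<in> V \<and> x - y \<in> V\<^sup>\<bottom>"
proof -
  have "x \<in> V + V\<^sup>\<bottom>"
    by (simp add: subspace_sum_orthogonal_comp[OF assms])
  then obtain y z where "x = y + z" "y \<in> V" "z \<in> V\<^sup>\<bottom>"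
    by (rule set_plus_elim)
  moreover have "y = y'" if "y \<in> V" "y' \<in> V" "x - y \<in> V\<^sup>\<bottom>" "x - y' \<in> V\<^sup>\<bottom>" for y y'
  proof -
    have "(x - y') - (x - y) \<in> V\<^sup>\<bottom>"
      by (rule subspace_diff[OF subspace_orthogonal_comp that(4,3)])
    moreover have "y - y' \<in> V"
      using that by (intro subspace_diff assms)
    ultimately have "y - y' \<in> V \<inter> V\<^sup>\<bottom>"
      by simp
    then show ?thesis
      unfolding orthogonal_Int_0[OF assms] by simp
  qed
  ultimately show ?thesis
    by (intro ex1I[of _ y]) auto
qed

lemma
  fixes V :: "'a::euclidean_space set"
  assumes "subspace V"
  shows orth_proj_in: "orth_proj V x \<in> V"
    and orth_proj_diff_in: "x - orth_proj V x \<in> V\<^sup>\<bottom>"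
  using theI'[OF orth_proj_decomp[OF assms, of x]] by (auto simp: orth_proj_def)

lemma orth_proj_unique:
  fixes V :: "'a::euclidean_space set"
  assumes "subspace V" "y \<in> V" "x - y \<in> V\<^sup>\<bottom>"
  shows "orth_proj V x = y"
  using orth_proj_decomp[OF assms(1), of x] orth_proj_in[OF assms(1), of x]
    orth_proj_diff_in[OF assms(1), of x] assms(2,3) by blast

lemma orth_proj_linear:
  fixes V :: "'a::euclidean_space set"
  assumes V: "subspace V"
  shows "linear (orth_proj V)"
proof (rule linearI)
  fix x y :: 'a and c :: real
  have "(x - orth_proj V x) + (y - orth_proj V y) \<in> V\<^sup>\<bottom>"
    by (intro subspace_add subspace_orthogonal_comp orth_proj_diff_in V)
  then show "orth_proj V (x + y) = orth_proj V x + orth_proj V y"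
    by (intro orth_proj_unique V subspace_add orth_proj_in) (simp add: algebra_simps)
  have "c *\<^sub>R (x - orth_proj V x) \<in> V\<^sup>\<bottom>"
    by (intro subspace_scale subspace_orthogonal_comp orth_proj_diff_in V)
  then show "orth_proj V (c *\<^sub>R x) = c *\<^sub>R orth_proj V x"
    by (intro orth_proj_unique V subspace_scale orth_proj_in) (simp add: algebra_simps)
qed

lemma orth_proj_id:
  fixes V :: "'a::euclidean_space set"
  assumes "subspace V" "x \<in> V"
  shows "orth_proj V x = x"
  using assms by (intro orth_proj_unique) (auto simp: subspace_0 subspace_orthogonal_comp)

lemma orth_proj_perp:
  fixes V :: "'a::euclidean_space set"
  assumes "subspace V"
  shows "orth_proj (V\<^sup>\<bottom>) x = x - orth_proj V x"
proof (rule orth_proj_unique)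
  show "x - (x - orth_proj V x) \<in> V\<^sup>\<bottom>\<^sup>\<bottom>"
    unfolding orthogonal_comp_self[OF assms] by (simp add: orth_proj_in assms)
qed (simp_all add: subspace_orthogonal_comp orth_proj_diff_in assms)

lemma norm_orth_proj_le:
  fixes V :: "'a::euclidean_space set"
  assumes "subspace V"
  shows "norm (orth_proj V x) \<le> norm x"
proof -
  have "orthogonal (orth_proj V x) (x - orth_proj V x)"
    using orth_proj_in[OF assms, of x] orth_proj_diff_in[OF assms, of x]
    unfolding orthogonal_comp_def by blast
  then have "(norm x)\<^sup>2 = (norm (orth_proj V x))\<^sup>2 + (norm (x - orth_proj V x))\<^sup>2"
    using norm_add_Pythagorean[of "orth_proj V x" "x - orth_proj V x"] by simp
  then have "(norm (orth_proj V x))\<^sup>2 \<le> (norm x)\<^sup>2"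
    using zero_le_power2[of "norm (x - orth_proj V x)"] by linarith
  then show ?thesis
    by (rule power2_le_imp_le) simp
qed

section \<open>Smooth maps and diffeomorphisms from affine lifts\<close>

lemma smooth_on_affine:
  fixes l :: "'a::euclidean_space \<Rightarrow> 'b::euclidean_space"
  assumes "linear l"
  shows "smooth_on S (\<lambda>x. l x + c)"
proof -
  have der: "((\<lambda>x. l x + c) has_derivative l) (at x)"
    if "linear l" for l :: "'a \<Rightarrow> 'b" and c x
    using linear_imp_has_derivative[OF that] by (auto intro!: derivative_eq_intros)
  have "Ck_on k S (\<lambda>x. l x + c)" if "linear l" for k and l :: "'a \<Rightarrow> 'b" and c
    using that
  proof (induction k arbitrary: l c)
    case 0
    then show ?case
      by (simp add: continuous_on_add linear_continuous_on linear_linear)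
  next
    case (Suc k)
    have "frechet_derivative (\<lambda>x. l x + c) (at x) = l" for x
      using frechet_derivative_at[OF der[OF Suc.prems]] by simp
    \<comment> \<open>The derivative in direction \<open>v\<close> is the constant
      \<open>l v\<close>; written as an affine map with linear part zero, it falls under the
      induction hypothesis.\<close>
    moreover have "Ck_on k S (\<lambda>x. (\<lambda>_. 0) x + l v)" for v
      by (intro Suc.IH) (simp add: linear_iff)
    ultimately show ?case
      using der[OF Suc.prems, of c] by (auto intro: differentiableI)
  qed
  then show ?thesis
    using assms by (auto simp: smooth_on_def)
qed

lemma
  assumes "smooth_on S f"
  shows smooth_on_imp_continuous_on: "continuous_on S f"
    and smooth_on_imp_differentiable: "x \<in> S \<Longrightarrow> f differentiable (at x)"
proof -
  have *: "Ck_on 0 S f" "Ck_on (Suc 0) S f"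
    using assms unfolding smooth_on_def by blast+
  show "continuous_on S f" "x \<in> S \<Longrightarrow> f differentiable (at x)"
    using * by auto
qed

text \<open>The trivializations and leaf isometries constructed later are all locally covered by
  affine maps, so this criterion settles their smoothness without computing derivatives.\<close>

lemma smooth_map_if_lift:
  assumes "\<And>x. q x \<in> D \<Longrightarrow>
    \<exists>l c. linear l \<and> (\<forall>\<^sub>F y in nhds x. r (l y + c) = h (q y))"
  shows "smooth_map q r D h"
  unfolding smooth_map_def
proof (intro allI impI)
  fix x assume "q x \<in> D"
  then obtain l c where l: "linear l" and "\<forall>\<^sub>F y in nhds x. r (l y + c) = h (q y)"
    using assms by blast
  then obtain V where "open V" "x \<in> V" "\<forall>y\<in>V. r (l y + c) = h (q y)"
    by (auto simp: eventually_nhds)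
  then show "\<exists>V g. open V \<and> x \<in> V \<and> smooth_on V g \<and> (\<forall>y\<in>V. r (g y) = h (q y))"
    by (intro exI[of _ V] exI[of _ "\<lambda>y. l y + c"]) (auto intro: smooth_on_affine l)
qed

text \<open>Replaces \<open>inv_into\<close> by an explicit inverse \<open>h'\<close>. The two agree
  only on \<open>E\<close>, so a local lift of \<open>h'\<close> has to be restricted to points
  lying over \<open>E\<close>; the last assumption says that these form an open set.\<close>

lemma diffeoI:
  fixes q :: "'c::euclidean_space \<Rightarrow> 'x" and r :: "'d::euclidean_space \<Rightarrow> 'y"
  assumes "smooth_map q r D h" "smooth_map r q E h'"
    and fwd: "\<And>m. m \<in> D \<Longrightarrow> h m \<in> E \<and> h' (h m) = m"
    and bwd: "\<And>y. y \<in> E \<Longrightarrow> h' y \<in> D \<and> h (h' y) = y"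
    and "\<And>y. r y \<in> E \<Longrightarrow> \<forall>\<^sub>F z in nhds y. r z \<in> E"
  shows "diffeo q r D E h"
proof -
  have bij: "bij_betw h D E"
    using fwd bwd by (intro bij_betw_byWitness[where f' = h']) auto
  then have inv: "inv_into D h y = h' y" if "y \<in> E" for y
    using bwd that by (metis bij_betw_imp_inj_on inv_into_f_eq)
  have "smooth_map r q E (inv_into D h)"
    unfolding smooth_map_def
  proof (intro allI impI)
    fix x assume x: "r x \<in> E"
    obtain V g where V: "open V" "x \<in> V" "smooth_on V g" "\<forall>y\<in>V. q (g y) = h' (r y)"
      using assms(2) x unfolding smooth_map_def by blast
    obtain V' where V': "open V'" "x \<in> V'" "\<forall>z\<in>V'. r z \<in> E"
      using assms(5)[OF x] by (auto simp: eventually_nhds)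
    have "Ck_on k (V \<inter> V') g" if "Ck_on k V g" for k and g :: "'d \<Rightarrow> 'c"
      using that by (induction k arbitrary: g) (auto intro: continuous_on_subset)
    then have "smooth_on (V \<inter> V') g"
      using V by (auto simp: smooth_on_def)
    then show "\<exists>V g. open V \<and> x \<in> V \<and> smooth_on V g \<and> (\<forall>y\<in>V. q (g y) = inv_into D h (r y))"
      using V V' inv by (intro exI[of _ "V \<inter> V'"] exI[of _ g]) auto
  qed
  then show ?thesis
    using assms(1) bij by (simp add: diffeo_def)
qed

section \<open>Discontinuity of the action\<close>

lemma orthogonal_matrix_norm:
  fixes A :: "real^'n^'n"
  assumes "orthogonal_matrix A"
  shows "norm (A *v x) = norm x"
proof -
  have "orthogonal_transformation ((*v) A)"
    using assms by (simp add: orthogonal_transformation_matrix matrix_of_matrix_vector_mul)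
  then show ?thesis
    by (simp add: orthogonal_transformation)
qed

lemma orthogonal_matrix_norm_le:
  fixes A :: "real^'n^'n"
  assumes "orthogonal_matrix A"
  shows "norm A \<le> CARD('n)"
proof -
  have "norm (A $ i) = 1" for i
    using assms orthogonal_matrix_orthonormal_rows[of A] by (simp add: row_def)
  moreover have "norm A \<le> (\<Sum>i\<in>UNIV. norm (A $ i))"
    unfolding norm_vec_def[of A] by (intro L2_set_le_sum) auto
  ultimately show ?thesis
    by simp
qed

lemma bounded_bilinear_matrix_mult:
  "bounded_bilinear (\<lambda>(A::real^'n^'n) (B::real^'n^'n). A ** B)"
  unfolding bilinear_conv_bounded_bilinear[symmetric] bilinear_def linear_iff
  by (intro conjI allI, simp_all only: matrix_add_ldistrib matrix_scalar_ac scalar_matrix_assoc)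
    (simp_all add: vec_eq_iff matrix_matrix_mult_def distrib_right sum.distrib)

text \<open>Left translation by the inverse of one element moves a pair of elements to a pair
  containing the identity and stretches distances by at most a fixed factor, because orthogonal
  matrices are uniformly bounded. Isolation of the identity therefore gives the same separation
  everywhere.\<close>

lemma discrete_subgroup_uniform_discrete:
  fixes H :: "'n::finite rigid set"
  assumes "subgroup H Iso" "discrete H"
  shows "uniform_discrete H"
proof -
  have "(mat 1, 0) \<in> H"
    using subgroup.one_closed[OF assms(1)] by (simp add: Iso_def)
  then obtain e where e: "e > 0" "\<And>g. g \<in> H \<Longrightarrow> dist (mat 1, 0) g < e \<Longrightarrow> g = (mat 1, 0)"
    using assms(2) unfolding discrete_def isolated_in_dist_Ex_iff by blast
  obtain K where K: "K > 0" "\<And>(A :: real^'n^'n) (B :: real^'n^'n). norm (A ** B) \<le> norm A * norm B * K"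
    using bounded_bilinear.pos_bounded[OF bounded_bilinear_matrix_mult[where 'n = 'n]]
    by blast
  \<comment> \<open>The first summand bounds left multiplication by an orthogonal matrix on
    matrices; the 1 accounts for the translation part, whose norm is preserved.\<close>
  define C where "C = CARD('n) * K + 1"
  have C: "C > 0"
    using K by (auto simp: C_def intro!: add_nonneg_pos)
  have "(B, w) = (A, v)" if g: "(A, v) \<in> H" and h: "(B, w) \<in> H"
    and d: "dist (A, v) (B, w) < e / C" for A B v w
  proof -
    have A: "orthogonal_matrix A"
      using g subgroup.subset[OF assms(1)] by (auto simp: Iso_def)
    let ?k = "(transpose A ** B, transpose A *v (w - v))"
    have inv: "inv\<^bsub>Iso\<^esub> (A, v) = (transpose A, - (transpose A *v v))"
      using A by (intro group.inv_equality[OF group_Iso])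
        (auto simp: Iso_def orthogonal_matrix_def)
    have "inv\<^bsub>Iso\<^esub> (A, v) \<otimes>\<^bsub>Iso\<^esub> (B, w) \<in> H"
      using g h assms(1) by (intro subgroup.m_closed subgroup.m_inv_closed)
    then have k: "?k \<in> H"
      unfolding inv by (simp add: Iso_def matrix_vector_mult_diff_distrib)
    have "?k - (mat 1, 0) = (transpose A ** (B - A), transpose A *v (w - v))"
      using A by (simp add: orthogonal_matrix_def bounded_bilinear.diff_right[OF bounded_bilinear_matrix_mult])
    moreover have "norm (transpose A ** (B - A)) \<le> CARD('n) * norm (B - A) * K"
      using A K(1) by (intro order_trans[OF K(2)] mult_right_mono orthogonal_matrix_norm_le) auto
    moreover have "norm (transpose A *v (w - v)) = norm (w - v)"
      using A by (intro orthogonal_matrix_norm) simp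
    ultimately have "norm (?k - (mat 1, 0)) \<le> CARD('n) * norm (B - A) * K + norm (w - v)"
      using norm_Pair_le[of "transpose A ** (B - A)" "transpose A *v (w - v)"] by simp
    also have "\<dots> \<le> CARD('n) * dist (A, v) (B, w) * K + dist (A, v) (B, w)"
      using dist_fst_le[of "(A, v)" "(B, w)"] dist_snd_le[of "(A, v)" "(B, w)"] K(1)
      by (intro add_mono mult_right_mono mult_left_mono) (auto simp: dist_norm norm_minus_commute)
    also have "\<dots> = C * dist (A, v) (B, w)"
      by (simp add: C_def algebra_simps)
    also have "\<dots> < e"
      using d C by (simp add: field_simps)
    finally have "?k = (mat 1, 0)"
      using e(2)[OF k] unfolding dist_norm norm_minus_commute[of "(mat 1, 0)"] by blast
    then have "transpose A ** B = mat 1" "transpose A *v (w - v) = 0"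
      by auto
    then have "A ** (transpose A ** B) = A" "norm (w - v) = 0"
      using orthogonal_matrix_norm[of "transpose A" "w - v"] A by (simp_all del: transpose_matrix_vector)
    then show ?thesis
      using A by (simp add: matrix_mul_assoc orthogonal_matrix_def)
  qed
  then show ?thesis
    unfolding uniform_discrete_def using e(1) C
    by (intro exI[of _ "e / C"]) (auto simp: split_paired_all)
qed

lemma act_eq: "act g x = fst g *v x + snd g"
  by (cases g) simp

lemma act_diff: "act g x - act g y = fst g *v (x - y)"
  by (simp add: act_eq matrix_vector_mult_diff_distrib)

lemma continuous_on_act [continuous_intros]:
  fixes f :: "'a::topological_space \<Rightarrow> real^'n"
  shows "continuous_on S f \<Longrightarrow> continuous_on S (\<lambda>x. act g (f x))"
  unfolding act_eq
  by (intro continuous_on_add continuous_on_const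
      bounded_linear.continuous_on[OF matrix_vector_mul_bounded_linear])

lemma norm_add_diff_le:
  fixes a b c :: "'a::real_normed_vector"
  shows "norm (a + b - c) \<le> norm a + norm b + norm c"
  using norm_triangle_ineq4[of "a + b" c] norm_triangle_ineq[of a b] by linarith

section \<open>Free and properly discontinuous action of a Bieberbach group\<close>

locale bieberbach_group =
  fixes \<pi> :: "'n::finite rigid set"
  assumes bieberbach: "bieberbach \<pi>"
begin

interpretation Iso: group "Iso :: 'n rigid monoid"
  by (rule group_Iso)

lemma subgroup: "subgroup \<pi> Iso"
  using bieberbach by (simp add: bieberbach_def crystallographic_def)

lemma carrier: "g \<in> \<pi> \<Longrightarrow> g \<in> carrier Iso"
  using subgroup.mem_carrier[OF subgroup] .

lemma mult_closed: "g \<in> \<pi> \<Longrightarrow> h \<in> \<pi> \<Longrightarrow> g \<otimes>\<^bsub>Iso\<^esub> h \<in> \<pi>"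
  by (rule subgroup.m_closed[OF subgroup])

lemma inv_closed: "g \<in> \<pi> \<Longrightarrow> inv\<^bsub>Iso\<^esub> g \<in> \<pi>"
  by (rule subgroup.m_inv_closed[OF subgroup])

lemma one_closed: "\<one>\<^bsub>Iso\<^esub> \<in> \<pi>"
  by (rule subgroup.one_closed[OF subgroup])

lemma act_one [simp]: "act \<one>\<^bsub>Iso\<^esub> x = x"
  by (simp add: Iso_def)

lemma act_inv [simp]: "g \<in> \<pi> \<Longrightarrow> act (inv\<^bsub>Iso\<^esub> g) (act g x) = x"
  and act_inv' [simp]: "g \<in> \<pi> \<Longrightarrow> act g (act (inv\<^bsub>Iso\<^esub> g) x) = x"
  by (simp_all add: carrier flip: act_mult)

lemma norm_linear_part [simp]: "g \<in> \<pi> \<Longrightarrow> norm (fst g *v x) = norm x"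
  using carrier[of g] by (intro orthogonal_matrix_norm) (auto simp: Iso_def)

lemma norm_act_diff [simp]: "g \<in> \<pi> \<Longrightarrow> norm (act g x - act g y) = norm (x - y)"
  by (simp add: act_diff)

lemma proj_M_eq_iff: "proj_M \<pi> x = proj_M \<pi> y \<longleftrightarrow> (\<exists>g\<in>\<pi>. y = act g x)"
proof
  assume "proj_M \<pi> x = proj_M \<pi> y"
  moreover have "y \<in> proj_M \<pi> y"
    unfolding proj_M_def using one_closed act_one by (metis image_eqI)
  ultimately show "\<exists>g\<in>\<pi>. y = act g x"
    by (auto simp: proj_M_def)
next
  assume "\<exists>g\<in>\<pi>. y = act g x"
  then obtain g where g: "g \<in> \<pi>" "y = act g x"
    by blast
  have "act k y \<in> proj_M \<pi> x" if "k \<in> \<pi>" for k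
    unfolding proj_M_def g using mult_closed[OF that g(1)] by (metis act_mult image_eqI)
  moreover have "act k x \<in> proj_M \<pi> y" if "k \<in> \<pi>" for k
    unfolding proj_M_def g using mult_closed[OF that inv_closed[OF g(1)]]
    by (metis act_inv act_mult g(1) image_eqI)
  ultimately show "proj_M \<pi> x = proj_M \<pi> y"
    by (auto simp: proj_M_def)
qed

lemma proj_M_act [simp]: "g \<in> \<pi> \<Longrightarrow> proj_M \<pi> (act g x) = proj_M \<pi> x"
  using proj_M_eq_iff by metis

text \<open>Linear parts are orthogonal and hence bounded, so a bound on the translation part makes
  the set bounded; bounded and uniformly discrete sets in a Euclidean space are finite.\<close>

lemma finite_bounded: "finite {g \<in> \<pi>. norm (snd g) \<le> r}"
proof -
  have "uniform_discrete \<pi>"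
    using bieberbach by (intro discrete_subgroup_uniform_discrete subgroup)
      (simp add: bieberbach_def crystallographic_def)
  then have "uniform_discrete {g \<in> \<pi>. norm (snd g) \<le> r}"
    by (rule uniform_discrete_subset) auto
  moreover have "norm g \<le> CARD('n) + r" if "g \<in> \<pi>" "norm (snd g) \<le> r" for g
  proof -
    have "norm (fst g) \<le> CARD('n)"
      using carrier[OF that(1)] by (intro orthogonal_matrix_norm_le) (auto simp: Iso_def)
    then show ?thesis
      using norm_Pair_le[of "fst g" "snd g"] that by simp
  qed
  then have "bounded {g \<in> \<pi>. norm (snd g) \<le> r}"
    unfolding bounded_iff by blast
  ultimately show ?thesis
    using uniform_discrete_finite_iff[of "{g \<in> \<pi>. norm (snd g) \<le> r}"] by simp
qed

lemma finite_moving: "finite {g \<in> \<pi>. norm (act g x - y) \<le> r}"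
proof (rule finite_subset[OF _ finite_bounded])
  have "norm (snd g) \<le> r + norm x + norm y" if "g \<in> \<pi>" "norm (act g x - y) \<le> r" for g
  proof -
    have "snd g = (act g x - y) + y - fst g *v x"
      by (simp add: act_eq)
    then have "norm (snd g) \<le> norm (act g x - y) + norm y + norm (fst g *v x)"
      by (metis norm_add_diff_le)
    then show ?thesis
      using that by simp
  qed
  then show "{g \<in> \<pi>. norm (act g x - y) \<le> r} \<subseteq> {g \<in> \<pi>. norm (snd g) \<le> r + norm x + norm y}"
    by blast
qed

text \<open>All powers of \<open>g\<close> fix \<open>x\<close>, and only finitely many elements do.
  Two powers coincide, so \<open>g\<close> has finite order and is trivial by
  torsion-freeness.\<close>

lemma free:
  assumes g: "g \<in> \<pi>" and fx: "act g x = x"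
  shows "g = \<one>\<^bsub>Iso\<^esub>"
proof -
  let ?p = "\<lambda>k::nat. g [^]\<^bsub>Iso\<^esub> k"
  have pow: "?p k \<in> \<pi> \<and> act (?p k) x = x" for k
    by (induction k) (simp_all add: one_closed mult_closed g fx act_mult)
  then have "range ?p \<subseteq> {g \<in> \<pi>. norm (act g x - x) \<le> 0}"
    by auto
  then have "finite (range ?p)"
    using finite_moving finite_subset by blast
  then have "\<not> inj ?p"
    using finite_imageD infinite_UNIV_nat by blast
  then obtain i j where "?p i = ?p j" "i < j"
    unfolding inj_def by (metis nat_neq_iff)
  then have "?p (j - i) = \<one>\<^bsub>Iso\<^esub>" "0 < j - i"
    using Iso.pow_eq_div2[OF carrier[OF g], of j i] by auto
  then show ?thesis
    using bieberbach g unfolding bieberbach_def torsion_free_def by blast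
qed

lemma free2:
  assumes g: "g \<in> \<pi>" and h: "h \<in> \<pi>" and "act g x = act h x"
  shows "g = h"
proof -
  have "act (inv\<^bsub>Iso\<^esub> h \<otimes>\<^bsub>Iso\<^esub> g) x = x"
    using assms by (simp add: act_mult)
  then have "inv\<^bsub>Iso\<^esub> h \<otimes>\<^bsub>Iso\<^esub> g = \<one>\<^bsub>Iso\<^esub>"
    using free mult_closed inv_closed g h by blast
  then have "h \<otimes>\<^bsub>Iso\<^esub> (inv\<^bsub>Iso\<^esub> h \<otimes>\<^bsub>Iso\<^esub> g) = h"
    by (simp add: carrier h)
  then show ?thesis
    by (simp add: carrier g h flip: Iso.m_assoc)
qed

text \<open>By cocompactness it is enough to bound displacements on \<open>K\<close>. There only
  finitely many elements are relevant, and each has a positive minimal displacement since the action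
  is free.\<close>

lemma displacement_bound: "\<exists>e>0. \<forall>g\<in>\<pi>. \<forall>x. norm (act g x - x) < e \<longrightarrow> g = \<one>\<^bsub>Iso\<^esub>"
proof -
  obtain K where K: "compact K" "\<And>x. \<exists>g\<in>\<pi>. act g x \<in> K"
    using bieberbach unfolding bieberbach_def crystallographic_def by blast
  obtain B where B: "\<And>k. k \<in> K \<Longrightarrow> norm k \<le> B"
    using compact_imp_bounded[OF K(1)] unfolding bounded_iff by blast
  have "K \<noteq> {}"
    using K(2) by blast
  \<comment> \<open>By the triangle inequality, \<open>F\<close> contains every nontrivial element
    that moves some point of \<open>K\<close> by less than 1.\<close>
  define F where "F = {g \<in> \<pi>. norm (act g 0 - 0) \<le> 1 + 2 * B} - {\<one>\<^bsub>Iso\<^esub>}"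
  have "finite F"
    unfolding F_def using finite_moving by blast
  have "\<exists>e>0. \<forall>k\<in>K. e \<le> norm (act g k - k)" if "g \<in> F" for g
  proof -
    have "continuous_on K (\<lambda>k. norm (act g k - k))"
      by (intro continuous_intros)
    then obtain k where k: "k \<in> K" "\<forall>l\<in>K. norm (act g k - k) \<le> norm (act g l - l)"
      using continuous_attains_inf[OF K(1) \<open>K \<noteq> {}\<close>] by blast
    moreover have "act g k \<noteq> k"
      using free[of g k] that unfolding F_def by blast
    ultimately show ?thesis
      by (intro exI[of _ "norm (act g k - k)"]) simp
  qed
  then obtain e where e: "\<And>g. g \<in> F \<Longrightarrow> e g > 0"
    "\<And>g k. g \<in> F \<Longrightarrow> k \<in> K \<Longrightarrow> e g \<le> norm (act g k - k)"
    by metis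
  define e' where "e' = Min (insert 1 (e ` F))"
  have e'_le: "e' \<le> 1" "\<And>g. g \<in> F \<Longrightarrow> e' \<le> e g"
    using \<open>finite F\<close> by (auto simp: e'_def)
  have "e' > 0"
    using \<open>finite F\<close> e(1) by (simp add: e'_def)
  moreover have "g = \<one>\<^bsub>Iso\<^esub>" if g: "g \<in> \<pi>" and x: "norm (act g x - x) < e'" for g x
  proof -
    obtain d where d: "d \<in> \<pi>" "act d x \<in> K"
      using K(2) by blast
    \<comment> \<open>Conjugating by \<open>d\<close> carries the displacement at \<open>x\<close>
      to an equal displacement at a point of \<open>K\<close>.\<close>
    let ?h = "d \<otimes>\<^bsub>Iso\<^esub> g \<otimes>\<^bsub>Iso\<^esub> inv\<^bsub>Iso\<^esub> d"
    let ?k = "act d x"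
    have h: "?h \<in> \<pi>"
      by (intro mult_closed inv_closed d g)
    have "norm (act ?h ?k - ?k) = norm (act g x - x)"
      using d by (simp add: act_mult)
    with x have small: "norm (act ?h ?k - ?k) < e'"
      by simp
    have "?h \<notin> F"
    proof
      assume "?h \<in> F"
      then show False
        using e(2)[OF _ d(2), of ?h] e'_le(2)[of ?h] small by linarith
    qed
    moreover have "norm (act ?h 0 - 0) \<le> 1 + 2 * B"
    proof -
      have "act ?h 0 - 0 = (act ?h ?k - ?k) + ?k - (act ?h ?k - act ?h 0)"
        by simp
      then have "norm (act ?h 0 - 0) \<le> norm (act ?h ?k - ?k) + norm ?k + norm (act ?h ?k - act ?h 0)"
        by (metis norm_add_diff_le)
      then show ?thesis
        using small e'_le(1) B[OF d(2)] norm_act_diff[OF h, of ?k 0] by simp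
    qed
    ultimately have "?h = \<one>\<^bsub>Iso\<^esub>"
      using h by (simp add: F_def)
    then have "act g x = x"
      using small \<open>norm (act ?h ?k - ?k) = norm (act g x - x)\<close> by simp
    then show ?thesis
      using free g by blast
  qed
  ultimately show ?thesis
    by blast
qed

definition sep :: real where
  "sep = (SOME e. e > 0 \<and> (\<forall>g\<in>\<pi>. \<forall>x. norm (act g x - x) < e \<longrightarrow> g = \<one>\<^bsub>Iso\<^esub>))"

lemma sep_pos: "sep > 0"
  and sep: "g \<in> \<pi> \<Longrightarrow> norm (act g x - x) < sep \<Longrightarrow> g = \<one>\<^bsub>Iso\<^esub>"
proof -
  have "sep > 0 \<and> (\<forall>g\<in>\<pi>. \<forall>x. norm (act g x - x) < sep \<longrightarrow> g = \<one>\<^bsub>Iso\<^esub>)"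
    unfolding sep_def by (rule someI_ex) (use displacement_bound in blast)
  then show "sep > 0" "g \<in> \<pi> \<Longrightarrow> norm (act g x - x) < sep \<Longrightarrow> g = \<one>\<^bsub>Iso\<^esub>"
    by blast+
qed

section \<open>Uniqueness and existence of lifts to Euclidean space\<close>

lemma proj_M_inj_near:
  assumes "proj_M \<pi> x = proj_M \<pi> y" "norm (x - y) < sep"
  shows "x = y"
proof -
  obtain g where "g \<in> \<pi>" "x = act g y"
    using assms(1) proj_M_eq_iff by metis
  then show ?thesis
    using sep assms(2) by fastforce
qed

text \<open>The set of agreement is closed by continuity. It is also open: two lifts closer than
  \<open>sep\<close> at a point lie in one orbit there and so coincide. Connectedness finishes the
  argument.\<close>

lemma lifts_agree:
  fixes k l :: "'a::real_normed_vector \<Rightarrow> real^'n"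
  assumes "continuous_on UNIV k" "continuous_on UNIV l"
    and "\<And>x. proj_M \<pi> (k x) = proj_M \<pi> (l x)" and "k a = l a"
  shows "k x = l x"
proof -
  have "{x. k x = l x} = {x. norm (k x - l x) < sep}"
    using proj_M_inj_near assms(3) sep_pos by auto
  moreover have "open {x. norm (k x - l x) < sep}"
    by (intro open_Collect_less continuous_intros assms)
  moreover have "closed {x. k x = l x}"
    by (intro closed_Collect_eq assms)
  ultimately have "{x. k x = l x} = UNIV"
    using clopen[of "{x. k x = l x}"] assms(4) by auto
  then show ?thesis
    by blast
qed

text \<open>The pullback \<open>{(x, y). proj_M \<pi> y = f x}\<close> of the covering \<open>\<real>\<^sup>n \<rightarrow> M\<^sub>\<pi>\<close> along \<open>f\<close> is a
  covering of a simply connected space, and its sections are the lifts of \<open>f\<close>.  This avoids a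
  topology on \<open>M\<^sub>\<pi>\<close>.\<close>

lemma lift_exists:
  fixes f :: "'a::euclidean_space \<Rightarrow> (real^'n) set"
  assumes C: "\<And>g x. g \<in> \<pi> \<Longrightarrow> x \<in> C \<Longrightarrow> act g x \<in> C \<Longrightarrow> act g ` C \<subseteq> C"
    and loc: "\<And>x. \<exists>V h. open V \<and> x \<in> V \<and> continuous_on V h \<and> (\<forall>y\<in>V. h y \<in> C \<and> proj_M \<pi> (h y) = f y)"
    and a: "a \<in> C" "proj_M \<pi> a = f z"
  obtains T where "continuous_on UNIV T" "T z = a" "\<And>x. T x \<in> C" "\<And>x. proj_M \<pi> (T x) = f x"
proof -
  define E where "E = {(x, y). y \<in> C \<and> proj_M \<pi> y = f x}"
  have E_iff: "(x, y) \<in> E \<longleftrightarrow> y \<in> C \<and> proj_M \<pi> y = f x" for x y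
    by (simp add: E_def)
  have "\<exists>T. x \<in> T \<and> openin (top_of_set UNIV) T \<and>
          (\<exists>v. \<Union>v = E \<inter> fst -` T \<and> (\<forall>u \<in> v. openin (top_of_set E) u) \<and>
               pairwise disjnt v \<and> (\<forall>u \<in> v. \<exists>q. homeomorphism u T fst q))" for x
  proof -
    obtain V h where V: "open V" "x \<in> V" "continuous_on V h"
      and h: "\<And>y. y \<in> V \<Longrightarrow> h y \<in> C" "\<And>y. y \<in> V \<Longrightarrow> proj_M \<pi> (h y) = f y"
      using loc[of x] by blast
    \<comment> \<open>These elements index the sheets over \<open>V\<close>: the sheet of
      \<open>g\<close> is the graph of \<open>h\<close> followed by \<open>g\<close>. By the
      assumption on \<open>C\<close>, an element taking one value of \<open>h\<close> into
      \<open>C\<close> already belongs to \<open>\<Gamma>\<close>.\<close>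
    define \<Gamma> where "\<Gamma> = {g \<in> \<pi>. act g ` C \<subseteq> C}"
    define sheet where "sheet g = (\<lambda>y. (y, act g (h y))) ` V" for g
    have union: "\<Union>(sheet ` \<Gamma>) = E \<inter> fst -` V"
    proof (intro equalityI subsetI)
      fix p assume "p \<in> \<Union>(sheet ` \<Gamma>)"
      then obtain g y where "g \<in> \<Gamma>" "y \<in> V" "p = (y, act g (h y))"
        by (auto simp: sheet_def)
      then show "p \<in> E \<inter> fst -` V"
        using h by (auto simp: E_iff \<Gamma>_def)
    next
      fix p assume "p \<in> E \<inter> fst -` V"
      then obtain y z where p: "p = (y, z)" "y \<in> V" "z \<in> C" "proj_M \<pi> z = f y"
        by (cases p) (auto simp: E_iff)
      then obtain g where g: "g \<in> \<pi>" "z = act g (h y)"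
        using h(2) proj_M_eq_iff by metis
      then have "g \<in> \<Gamma>"
        using C[OF g(1) h(1)[OF p(2)]] p(3) by (simp add: \<Gamma>_def)
      then show "p \<in> \<Union>(sheet ` \<Gamma>)"
        using p g by (auto simp: sheet_def)
    qed
    have "openin (top_of_set E) (sheet g)" if g: "g \<in> \<Gamma>" for g
    proof -
      \<comment> \<open>A point of \<open>E\<close> over \<open>V\<close> lies on the sheet of
        \<open>g\<close> as soon as it is closer than \<open>sep\<close> to it vertically, which is
        an open condition.\<close>
      let ?d = "\<lambda>p. snd p - act g (h (fst p))"
      have "continuous_on (V \<times> UNIV) (\<lambda>p. h (fst p))"
        by (rule continuous_on_compose2[OF V(3) continuous_on_fst[OF continuous_on_id]]) auto
      then have "continuous_on (V \<times> UNIV) ?d"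
        by (intro continuous_intros)
      then have "open (V \<times> UNIV \<inter> ?d -` ball 0 sep)"
        using V(1) by (intro continuous_open_preimage open_Times) auto
      moreover have "sheet g = E \<inter> (V \<times> UNIV \<inter> ?d -` ball 0 sep)"
      proof (intro equalityI subsetI)
        fix p assume p: "p \<in> sheet g"
        then have "p \<in> E"
          using union g by blast
        then show "p \<in> E \<inter> (V \<times> UNIV \<inter> ?d -` ball 0 sep)"
          using p sep_pos by (auto simp: sheet_def)
      next
        fix p assume "p \<in> E \<inter> (V \<times> UNIV \<inter> ?d -` ball 0 sep)"
        then obtain y z where p: "p = (y, z)" "y \<in> V" "proj_M \<pi> z = f y" "norm (z - act g (h y)) < sep"
          by (cases p) (auto simp: E_iff)
        moreover have "proj_M \<pi> (act g (h y)) = f y"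
          using g h p by (simp add: \<Gamma>_def)
        ultimately have "z = act g (h y)"
          using proj_M_inj_near by metis
        then show "p \<in> sheet g"
          using p by (simp add: sheet_def)
      qed
      ultimately show ?thesis
        by (simp add: openin_open_Int)
    qed
    moreover have "pairwise disjnt (sheet ` \<Gamma>)"
    proof (rule pairwiseI)
      fix u v assume "u \<in> sheet ` \<Gamma>" "v \<in> sheet ` \<Gamma>" "u \<noteq> v"
      then obtain g k where gk: "g \<in> \<pi>" "k \<in> \<pi>" "u = sheet g" "v = sheet k" "g \<noteq> k"
        by (auto simp: \<Gamma>_def)
      then have "act g (h y) \<noteq> act k (h y)" for y
        using free2 by blast
      then show "disjnt u v"
        unfolding gk disjnt_def sheet_def by auto
    qed
    moreover have "homeomorphism (sheet g) V fst (\<lambda>y. (y, act g (h y)))" for g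
      by (intro homeomorphismI continuous_intros V) (auto simp: sheet_def)
    then have "\<exists>q. homeomorphism u V fst q" if "u \<in> sheet ` \<Gamma>" for u
      using that by blast
    ultimately show ?thesis
      using V union by (intro exI[of _ V] conjI exI[of _ "sheet ` \<Gamma>"]) (simp_all, blast?)
  qed
  moreover have "fst ` E = UNIV"
  proof -
    have "x \<in> fst ` E" for x
    proof -
      obtain V h where "x \<in> V" "\<forall>y\<in>V. h y \<in> C \<and> proj_M \<pi> (h y) = f y"
        using loc[of x] by blast
      then have "(x, h x) \<in> E"
        by (simp add: E_iff)
      then show ?thesis
        by force
    qed
    then show ?thesis
      by blast
  qed
  moreover have "continuous_on E fst"
    by (intro continuous_intros)
  ultimately have "covering_space E fst UNIV"
    unfolding covering_space_def by blast
  moreover have "(z, a) \<in> E"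
    using a by (simp add: E_iff)
  moreover have "simply_connected (UNIV :: 'a set)"
    by (intro convex_imp_simply_connected convex_UNIV)
  moreover have "locally path_connected (UNIV :: 'a set)"
    by (intro convex_imp_locally_path_connected convex_UNIV)
  \<comment> \<open>Lifting the identity of the base gives a section through \<open>(z, a)\<close>;
    its second component is the required map.\<close>
  ultimately obtain g where g: "continuous_on UNIV g" "g \<in> UNIV \<rightarrow> E" "g z = (z, a)" "\<And>y. fst (g y) = y"
    using covering_space_lift_strong[of E fst UNIV "(z, a)" z UNIV "\<lambda>x. x"] by auto
  have "snd (g x) \<in> C" "proj_M \<pi> (snd (g x)) = f x" for x
  proof -
    have "g x = (x, snd (g x))"
      using g(4) by (metis prod.collapse)
    then show "snd (g x) \<in> C" "proj_M \<pi> (snd (g x)) = f x"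
      using g(2) E_iff by (metis PiE UNIV_I)+
  qed
  then show ?thesis
    using g by (intro that[of "\<lambda>x. snd (g x)"]) (auto intro: continuous_intros)
qed

end

section \<open>The foliation\<close>

locale subspace_foliation = bieberbach_group \<pi> for \<pi> :: "'n::finite rigid set" +
  fixes W :: "(real^'n) set"
  assumes subspace_W: "subspace W"
    and invariant: "invariant_under (holonomy \<pi>) W"
    and generated: "generated_by_lattice (lattice_of \<pi>) W"
begin

text \<open>The affine subspaces parallel to \<open>W\<close> are the level sets of
  \<open>Q\<close>, and \<open>g\<close> acts on the orthogonal complement by
  \<open>x \<mapsto> Q (act g x)\<close>. Leaves, stabilizers and exceptional leaves are all treated
  through \<open>Q\<close>; positions along a leaf through \<open>P\<close>.\<close>

definition P :: "real^'n \<Rightarrow> real^'n" where "P = orth_proj W"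
definition Q :: "real^'n \<Rightarrow> real^'n" where "Q = orth_proj (W\<^sup>\<bottom>)"

lemma Q_eq: "Q x = x - P x"
  by (simp add: P_def Q_def orth_proj_perp subspace_W)

lemma decomp: "P x + Q x = x"
  by (simp add: Q_eq)

lemma P_in [simp]: "P x \<in> W"
  by (simp add: P_def orth_proj_in subspace_W)

lemma Q_in [simp]: "Q x \<in> W\<^sup>\<bottom>"
  by (simp add: Q_def orth_proj_in subspace_orthogonal_comp)

lemma linear_P: "linear P" and linear_Q: "linear Q"
  by (simp_all add: P_def Q_def orth_proj_linear subspace_W subspace_orthogonal_comp)

lemmas P_simps [simp] = linear_add[OF linear_P] linear_diff[OF linear_P] linear_0[OF linear_P]
  linear_neg[OF linear_P] linear_scale[OF linear_P]

lemmas Q_simps [simp] = linear_add[OF linear_Q] linear_diff[OF linear_Q] linear_0[OF linear_Q]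
  linear_neg[OF linear_Q] linear_scale[OF linear_Q]

lemma P_id: "x \<in> W \<Longrightarrow> P x = x"
  by (simp add: P_def orth_proj_id subspace_W)

lemma Q_id: "x \<in> W\<^sup>\<bottom> \<Longrightarrow> Q x = x"
  by (simp add: Q_def orth_proj_id subspace_orthogonal_comp)

lemma PP [simp]: "P (P x) = P x" and QQ [simp]: "Q (Q x) = Q x"
  by (simp_all add: P_id Q_id)

lemma PQ [simp]: "P (Q x) = 0" and QP [simp]: "Q (P x) = 0"
  by (simp_all add: Q_eq)

lemma Q_eq_0_iff: "Q x = 0 \<longleftrightarrow> x \<in> W"
  by (metis P_id P_in Q_eq eq_iff_diff_eq_0)

lemma norm_P_le: "norm (P x) \<le> norm x"
  by (simp add: P_def norm_orth_proj_le subspace_W)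

lemma norm_Q_le: "norm (Q x) \<le> norm x"
  by (simp add: Q_def norm_orth_proj_le subspace_orthogonal_comp)

lemma linear_part_W: "g \<in> \<pi> \<Longrightarrow> x \<in> W \<Longrightarrow> fst g *v x \<in> W"
  using invariant unfolding invariant_under_def holonomy_def
  by (metis (mono_tags, lifting) mem_Collect_eq prod.collapse)

lemma linear_part_inner: "g \<in> \<pi> \<Longrightarrow> (fst g *v x) \<bullet> (fst g *v y) = x \<bullet> y"
proof -
  assume g: "g \<in> \<pi>"
  have "orthogonal_transformation ((*v) (fst g))"
    using norm_linear_part[OF g] by (simp add: orthogonal_transformation)
  then show ?thesis
    by (simp add: orthogonal_transformation_def)
qed

lemma linear_part_W_perp:
  assumes g: "g \<in> \<pi>" and x: "x \<in> W\<^sup>\<bottom>"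
  shows "fst g *v x \<in> W\<^sup>\<bottom>"
proof -
  have "y \<bullet> (fst g *v x) = 0" if y: "y \<in> W" for y
  proof -
    let ?z = "fst (inv\<^bsub>Iso\<^esub> g) *v y"
    \<comment> \<open>Taking the difference with the image of 0 cancels the translation parts, so
      the linear part of \<open>g\<close> undoes that of its inverse without an explicit inverse
      formula.\<close>
    have "y = act g (act (inv\<^bsub>Iso\<^esub> g) y) - act g (act (inv\<^bsub>Iso\<^esub> g) 0)"
      by (simp only: act_inv'[OF g] diff_zero)
    then have "y = fst g *v ?z"
      by (simp only: act_diff diff_zero)
    moreover have "?z \<in> W"
      using linear_part_W inv_closed[OF g] y by blast
    then have "?z \<bullet> x = 0"
      using x by (simp add: orthogonal_comp_def orthogonal_def)
    ultimately show ?thesis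
      using linear_part_inner[OF g] by metis
  qed
  then show ?thesis
    by (simp add: orthogonal_comp_def orthogonal_def)
qed

lemma P_linear_part: "g \<in> \<pi> \<Longrightarrow> P (fst g *v x) = fst g *v P x"
  unfolding P_def
  by (intro orth_proj_unique linear_part_W subspace_W orth_proj_in)
    (simp_all add: linear_part_W_perp orth_proj_diff_in subspace_W
      flip: matrix_vector_mult_diff_distrib)

lemma Q_linear_part: "g \<in> \<pi> \<Longrightarrow> Q (fst g *v x) = fst g *v Q x"
  by (simp add: Q_eq P_linear_part matrix_vector_mult_diff_distrib)

lemma P_act: "g \<in> \<pi> \<Longrightarrow> P (act g x) = fst g *v P x + P (snd g)"
  by (simp add: act_eq P_linear_part)

lemma Q_act: "g \<in> \<pi> \<Longrightarrow> Q (act g x) = fst g *v Q x + Q (snd g)"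
  by (simp add: act_eq Q_linear_part)

lemma Q_act_Q: "g \<in> \<pi> \<Longrightarrow> Q (act g (Q x)) = Q (act g x)"
  by (simp add: Q_act)

lemma Q_act_cong: "g \<in> \<pi> \<Longrightarrow> Q x = Q y \<Longrightarrow> Q (act g x) = Q (act g y)"
  by (simp add: Q_act)

lemma G_W_iff: "g \<in> G_W \<pi> W u \<longleftrightarrow> g \<in> \<pi> \<and> Q (act g u) = Q u"
proof -
  have "(A - mat 1) *v u + v = act (A, v) u - u" for A v
    by (simp add: matrix_vector_mult_diff_rdistrib algebra_simps)
  then have "g \<in> G_W \<pi> W u \<longleftrightarrow> g \<in> \<pi> \<and> act g u - u \<in> W"
    unfolding G_W_def by (cases g) (simp del: act.simps)
  then show ?thesis
    by (simp flip: Q_eq_0_iff)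
qed

subsection \<open>Leaves\<close>

lemma proj_M_in_leaf_iff: "proj_M \<pi> x \<in> leaf \<pi> W u \<longleftrightarrow> (\<exists>g\<in>\<pi>. Q (act g x) = Q u)"
proof
  assume "proj_M \<pi> x \<in> leaf \<pi> W u"
  then obtain w where "w \<in> W" "proj_M \<pi> x = proj_M \<pi> (w + u)"
    by (auto simp: leaf_def)
  then obtain g where "g \<in> \<pi>" "act g x = w + u" "Q w = 0"
    using proj_M_eq_iff Q_eq_0_iff by metis
  then show "\<exists>g\<in>\<pi>. Q (act g x) = Q u"
    by (intro bexI[of _ g]) simp_all
next
  assume "\<exists>g\<in>\<pi>. Q (act g x) = Q u"
  then obtain g where g: "g \<in> \<pi>" "Q (act g x) = Q u"
    by blast
  then have "act g x - u \<in> W"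
    by (simp flip: Q_eq_0_iff)
  then have "proj_M \<pi> ((act g x - u) + u) \<in> leaf \<pi> W u"
    unfolding leaf_def by blast
  then show "proj_M \<pi> x \<in> leaf \<pi> W u"
    using g by simp
qed

lemma proj_M_in_leaf: "proj_M \<pi> x \<in> leaf \<pi> W x"
  using proj_M_in_leaf_iff one_closed act_one by metis

lemma leaf_eqI:
  assumes g: "g \<in> \<pi>" "Q (act g x) = Q y"
  shows "leaf \<pi> W x = leaf \<pi> W y"
proof -
  have "proj_M \<pi> z \<in> leaf \<pi> W x \<longleftrightarrow> proj_M \<pi> z \<in> leaf \<pi> W y" for z
  proof
    assume "proj_M \<pi> z \<in> leaf \<pi> W x"
    then obtain h where h: "h \<in> \<pi>" "Q (act h z) = Q x"
      using proj_M_in_leaf_iff by blast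
    then have "Q (act (g \<otimes>\<^bsub>Iso\<^esub> h) z) = Q y"
      using Q_act_cong[OF g(1) h(2)] g by (simp add: act_mult)
    then show "proj_M \<pi> z \<in> leaf \<pi> W y"
      using proj_M_in_leaf_iff mult_closed g h by blast
  next
    assume "proj_M \<pi> z \<in> leaf \<pi> W y"
    then obtain h where h: "h \<in> \<pi>" "Q (act h z) = Q y"
      using proj_M_in_leaf_iff by blast
    have "Q (act (inv\<^bsub>Iso\<^esub> g) (act h z)) = Q (act (inv\<^bsub>Iso\<^esub> g) (act g x))"
      using h g by (intro Q_act_cong inv_closed) simp_all
    then have "Q (act (inv\<^bsub>Iso\<^esub> g \<otimes>\<^bsub>Iso\<^esub> h) z) = Q x"
      using g by (simp add: act_mult)
    then show "proj_M \<pi> z \<in> leaf \<pi> W x"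
      using proj_M_in_leaf_iff mult_closed inv_closed g h by blast
  qed
  moreover have "leaf \<pi> W u \<subseteq> range (proj_M \<pi>)" for u
    unfolding leaf_def by blast
  ultimately show ?thesis
    by blast
qed

lemma leaf_eq_iff: "leaf \<pi> W x = leaf \<pi> W y \<longleftrightarrow> (\<exists>g\<in>\<pi>. Q (act g x) = Q y)"
  using leaf_eqI proj_M_in_leaf proj_M_in_leaf_iff by metis

lemma leaf_proj_proj_M [simp]: "leaf_proj \<pi> W (proj_M \<pi> x) = leaf \<pi> W x"
proof -
  have "leaf \<pi> W u = leaf \<pi> W x" if "proj_M \<pi> x \<in> leaf \<pi> W u" for u
    using that leaf_eqI proj_M_in_leaf_iff by metis
  then show ?thesis
    unfolding leaf_proj_def leaf_space_def by (intro the_equality) (auto simp: proj_M_in_leaf)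
qed

lemma leaf_cover_eq: "leaf_cover \<pi> W u x = proj_M \<pi> (P x + u)"
  by (simp add: leaf_cover_def P_def)

lemma range_leaf_cover: "range (leaf_cover \<pi> W u) = leaf \<pi> W u"
proof -
  have "range P = W"
    using P_id P_in by (metis subsetI subset_antisym image_subsetI rangeI)
  have "range (leaf_cover \<pi> W u) = proj_M \<pi> ` (\<lambda>w. w + u) ` range P"
    by (simp only: leaf_cover_eq[abs_def] image_image)
  then show ?thesis
    by (simp only: leaf_def \<open>range P = W\<close>)
qed

subsection \<open>Finiteness modulo the lattice\<close>

lemma lattice_diff:
  assumes "v \<in> lattice_of \<pi>" "w \<in> lattice_of \<pi>"
  shows "v - w \<in> lattice_of \<pi>"
proof -
  have v: "(mat 1, v) \<in> \<pi>" and w: "(mat 1, w) \<in> \<pi>"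
    using assms by (simp_all add: lattice_of_def)
  let ?h = "inv\<^bsub>Iso\<^esub> (mat 1, w)"
  have "inv\<^bsub>Iso\<^esub> (mat 1, w) = (mat 1, - w)"
    by (intro group.inv_equality[OF group_Iso]) (simp_all add: Iso_def orthogonal_matrix_id)
  then have "(mat 1, - w) \<in> \<pi>"
    using inv_closed[OF w] by simp
  from mult_closed[OF v this] show ?thesis
    by (simp add: Iso_def lattice_of_def)
qed

lemma lattice_of_int_scale: "v \<in> lattice_of \<pi> \<Longrightarrow> of_int k *\<^sub>R v \<in> lattice_of \<pi>"
proof (induction k rule: int_induct[where k = 0])
  case base
  then show ?case
    using lattice_diff[of v v] by simp
next
  case (step1 i)
  have "- v \<in> lattice_of \<pi>"
    using lattice_diff[of "v - v" v] lattice_diff[of v v] step1.prems by simp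
  then show ?case
    using lattice_diff[of "of_int i *\<^sub>R v" "- v"] step1 by (simp add: scaleR_left_distrib)
next
  case (step2 i)
  then show ?case
    using lattice_diff[of "of_int i *\<^sub>R v" v] by (simp add: scaleR_left_diff_distrib)
qed

lemma lattice_sum:
  assumes "finite B" "B \<subseteq> lattice_of \<pi>"
  shows "(\<Sum>b\<in>B. of_int (k b) *\<^sub>R b) \<in> lattice_of \<pi>"
  using assms
proof (induction B rule: finite_induct)
  case empty
  then show ?case
    using one_closed by (simp add: lattice_of_def Iso_def)
next
  case (insert b B)
  have "of_int (- k b) *\<^sub>R b \<in> lattice_of \<pi>"
    using insert.prems by (intro lattice_of_int_scale) blast
  then show ?case
    using lattice_diff[of "\<Sum>b\<in>B. of_int (k b) *\<^sub>R b" "of_int (- k b) *\<^sub>R b"] insert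
    by (simp add: add.commute)
qed

text \<open>Here the assumption that \<open>W\<close> is generated by the lattice enters: it
  supplies a basis of \<open>W\<close> made of lattice vectors, and subtracting the integer parts of
  the coordinates leaves a point of a fixed parallelepiped.\<close>

lemma lattice_cobounded: "\<exists>R. \<forall>z\<in>W. \<exists>l\<in>W. (mat 1, l) \<in> \<pi> \<and> norm (z + l) \<le> R"
proof -
  obtain B where B: "B \<subseteq> W \<inter> lattice_of \<pi>" "independent B" "W \<inter> lattice_of \<pi> \<subseteq> span B"
    using maximal_independent_subset by blast
  have fin: "finite B"
    using B(2) independent_bound by blast
  have "W \<subseteq> span B"
    using generated B(3) unfolding generated_by_lattice_def
    by (metis span_minimal subspace_span)
  have "\<exists>l\<in>W. (mat 1, l) \<in> \<pi> \<and> norm (z + l) \<le> (\<Sum>b\<in>B. norm b)" if z: "z \<in> W" for z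
  proof -
    obtain c where c: "z = (\<Sum>b\<in>B. c b *\<^sub>R b)"
      using z \<open>W \<subseteq> span B\<close> span_finite[OF fin] by blast
    let ?l = "\<Sum>b\<in>B. of_int (- \<lfloor>c b\<rfloor>) *\<^sub>R b"
    have "?l \<in> lattice_of \<pi>"
      using B(1) by (intro lattice_sum fin) blast
    moreover have "?l \<in> W"
      using B(1) by (intro subspace_sum subspace_scale subspace_W) blast
    moreover have "norm (z + ?l) \<le> (\<Sum>b\<in>B. norm b)"
    proof -
      have "z + ?l = (\<Sum>b\<in>B. frac (c b) *\<^sub>R b)"
        unfolding c frac_def by (simp add: scaleR_left_diff_distrib sum_subtractf sum_negf)
      also have "norm \<dots> \<le> (\<Sum>b\<in>B. norm b)"
      proof (rule sum_norm_le)
        show "norm (frac (c b) *\<^sub>R b) \<le> norm b" for b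
          using frac_ge_0[of "c b"] frac_lt_1[of "c b"] by (simp add: mult_left_le_one_le)
      qed
      finally show ?thesis .
    qed
    ultimately show ?thesis
      by (auto simp: lattice_of_def)
  qed
  then show ?thesis
    by blast
qed

text \<open>Proper discontinuity on the orthogonal complement. Composing with a translation in
  \<open>W\<close> does not change the action there, and a suitable lattice translation makes the
  \<open>W\<close>-component of \<open>snd g\<close> bounded; then \<open>finite_bounded\<close>
  applies.\<close>

lemma finite_mod_lattice:
  obtains F where "finite F" "F \<subseteq> \<pi>"
    "\<And>g. g \<in> \<pi> \<Longrightarrow> norm (Q (snd g)) \<le> r \<Longrightarrow> \<exists>h\<in>F. \<forall>x. Q (act h x) = Q (act g x)"
proof -
  obtain R where R: "\<And>z. z \<in> W \<Longrightarrow> \<exists>l\<in>W. (mat 1, l) \<in> \<pi> \<and> norm (z + l) \<le> R"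
    using lattice_cobounded by blast
  let ?F = "{h \<in> \<pi>. norm (snd h) \<le> R + r}"
  have "\<exists>h\<in>?F. \<forall>x. Q (act h x) = Q (act g x)"
    if g: "g \<in> \<pi>" and r: "norm (Q (snd g)) \<le> r" for g
  proof -
    obtain l where l: "l \<in> W" "(mat 1, l) \<in> \<pi>" "norm (P (snd g) + l) \<le> R"
      using R P_in by blast
    let ?h = "(mat 1, l) \<otimes>\<^bsub>Iso\<^esub> g"
    have "snd ?h = (P (snd g) + l) + Q (snd g)"
      using decomp[of "snd g"] by (cases g) (simp add: Iso_def algebra_simps)
    then have "norm (snd ?h) \<le> R + r"
      using norm_triangle_le[of "P (snd g) + l" "Q (snd g)"] l r by simp
    moreover have "?h \<in> \<pi>"
      using mult_closed l g by blast
    moreover have "Q (act ?h x) = Q (act g x)" for x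
      using l Q_eq_0_iff[of l] by (simp add: act_mult)
    ultimately show ?thesis
      by blast
  qed
  then show ?thesis
    using finite_bounded[of "R + r"] by (intro that[of ?F]) auto
qed

subsection \<open>Algebraic forms of the absence of exceptional leaves\<close>

text \<open>The working form of condition (iii): an element that fixes one point of the orthogonal
  complement acts trivially on it. The other conditions are compared with this one.\<close>

lemma no_exceptional_iff:
  "(\<forall>u. \<not> exceptional \<pi> W u) \<longleftrightarrow> (\<forall>g\<in>\<pi>. \<forall>u. Q (act g u) = Q u \<longrightarrow> (\<forall>u'. Q (act g u') = Q u'))"
  unfolding exceptional_def subset_iff G_W_iff by blast

text \<open>\<open>Q (act g u)\<close> depends on \<open>u\<close> only through \<open>Q u\<close>,
  so quantifying over all points amounts to quantifying over the orthogonal complement.\<close>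

lemma no_exceptional_iff_smooth:
  "(\<forall>u. \<not> exceptional \<pi> W u) \<longleftrightarrow> leaf_space_smooth \<pi> W"
proof -
  have perp: "perp_group \<pi> W = (\<lambda>g. restrict (\<lambda>x. Q (act g x)) (W\<^sup>\<bottom>)) ` \<pi>"
  proof -
    have "restrict (\<lambda>x. A *v x + orth_proj (W\<^sup>\<bottom>) v) (W\<^sup>\<bottom>) = restrict (\<lambda>x. Q (act (A, v) x)) (W\<^sup>\<bottom>)"
      if "(A, v) \<in> \<pi>" for A v
    proof (rule restrict_ext)
      fix x assume "x \<in> W\<^sup>\<bottom>"
      then show "A *v x + orth_proj (W\<^sup>\<bottom>) v = Q (act (A, v) x)"
        unfolding Q_act[OF that] by (simp add: Q_id) (simp add: Q_def)
    qed
    then have "perp_group \<pi> W = {restrict (\<lambda>x. Q (act (A, v) x)) (W\<^sup>\<bottom>) | A v. (A, v) \<in> \<pi>}"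
      unfolding perp_group_def by (metis (no_types, lifting))
    then show ?thesis
      by (auto simp del: act.simps)
  qed
  have "leaf_space_smooth \<pi> W \<longleftrightarrow>
      (\<forall>x\<in>W\<^sup>\<bottom>. \<forall>g\<in>\<pi>. Q (act g x) = x \<longrightarrow> (\<forall>y\<in>W\<^sup>\<bottom>. Q (act g y) = y))"
    unfolding leaf_space_smooth_def perp by (auto simp: restrict_def fun_eq_iff split: if_splits)
  also have "\<dots> \<longleftrightarrow> (\<forall>g\<in>\<pi>. \<forall>u. Q (act g u) = Q u \<longrightarrow> (\<forall>u'. Q (act g u') = Q u'))"
  proof (intro iffI ballI allI impI)
    fix g u u'
    assume *: "\<forall>x\<in>W\<^sup>\<bottom>. \<forall>g\<in>\<pi>. Q (act g x) = x \<longrightarrow> (\<forall>y\<in>W\<^sup>\<bottom>. Q (act g y) = y)"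
      and g: "g \<in> \<pi>" "Q (act g u) = Q u"
    then have "Q (act g (Q u)) = Q u"
      by (simp only: Q_act_Q)
    then have "Q (act g (Q u')) = Q u'"
      using * g(1) Q_in by blast
    then show "Q (act g u') = Q u'"
      by (simp only: Q_act_Q g)
  next
    fix x g y
    assume *: "\<forall>g\<in>\<pi>. \<forall>u. Q (act g u) = Q u \<longrightarrow> (\<forall>u'. Q (act g u') = Q u')"
      and g: "g \<in> \<pi>" "Q (act g x) = x" and x: "x \<in> W\<^sup>\<bottom>" and y: "y \<in> W\<^sup>\<bottom>"
    have "Q (act g x) = Q x"
      using g x by (simp only: Q_id)
    then have "Q (act g y) = Q y"
      using * g(1) by blast
    then show "Q (act g y) = y"
      using y by (simp only: Q_id)
  qed
  finally show ?thesis
    using no_exceptional_iff by simp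
qed

text \<open>On the orthogonal complement \<open>(A, v)\<close> acts by
  \<open>x \<mapsto> A *v x + Q v\<close>. A fixed point exists exactly when \<open>Q v\<close> lies
  in the image of \<open>A - mat 1\<close>, and in that case the action is trivial exactly when
  \<open>A\<close> is the identity there.\<close>

lemma no_exceptional_iff_no_fixpoint:
  "(\<forall>u. \<not> exceptional \<pi> W u) \<longleftrightarrow> (\<forall>(A, v)\<in>\<pi>. (\<exists>x\<in>W\<^sup>\<bottom>. A *v x \<noteq> x) \<longrightarrow>
     orth_proj (W\<^sup>\<bottom>) v \<notin> range (\<lambda>x. (A - mat 1) *v x))"
proof -
  have "(\<forall>u. Q (act g u) = Q u \<longrightarrow> (\<forall>u'. Q (act g u') = Q u')) \<longleftrightarrow>
     ((\<exists>x\<in>W\<^sup>\<bottom>. A *v x \<noteq> x) \<longrightarrow> Q v \<notin> range (\<lambda>x. (A - mat 1) *v x))" (is "?L \<longleftrightarrow> ?R")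
    if g: "g \<in> \<pi>" "g = (A, v)" for g A v
  proof
    assume L: ?L
    show ?R
    proof (intro impI notI)
      assume "\<exists>x\<in>W\<^sup>\<bottom>. A *v x \<noteq> x" and "Q v \<in> range (\<lambda>x. (A - mat 1) *v x)"
      then obtain x y where x: "x \<in> W\<^sup>\<bottom>" "A *v x \<noteq> x" and "Q v = A *v y - y"
        by (auto simp: matrix_vector_mult_diff_rdistrib)
      \<comment> \<open>The preimage \<open>y\<close> may have a component in \<open>W\<close>;
        applying \<open>Q\<close> removes it, and \<open>- Q y\<close> is then a fixed
        point.\<close>
      then have "Q (Q v) = A *v Q y - Q y"
        using Q_linear_part[OF g(1), of y] g(2) by simp
      then have "Q (act g (- y)) = Q (- y)"
        using Q_act[OF g(1), of "- y"] g(2)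
        by (simp add: linear_neg[OF matrix_vector_mul_linear])
      \<comment> \<open>Triviality at 0 gives \<open>Q v = 0\<close>; with triviality at
        \<open>x\<close> it forces \<open>A *v x = x\<close>.\<close>
      then have "Q (act g 0) = Q 0" "Q (act g x) = Q x"
        using L by blast+
      then show False
        using x Q_act[OF g(1)] g(2) by (simp add: Q_id)
    qed
  next
    assume R: ?R
    show ?L
    proof (intro allI impI)
      fix u u' assume "Q (act g u) = Q u"
      then have u: "A *v Q u + Q v = Q u"
        using Q_act[OF g(1)] g(2) by simp
      then have "Q v = (A - mat 1) *v (- Q u)"
        by (simp add: matrix_vector_mult_diff_rdistrib linear_neg[OF matrix_vector_mul_linear]
            algebra_simps)
      then have "A *v x = x" if "x \<in> W\<^sup>\<bottom>" for x
        using R that by blast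
      then show "Q (act g u') = Q u'"
        using u Q_act[OF g(1)] g(2) by simp
    qed
  qed
  then have "(\<forall>g\<in>\<pi>. \<forall>u. Q (act g u) = Q u \<longrightarrow> (\<forall>u'. Q (act g u') = Q u')) \<longleftrightarrow>
      (\<forall>(A, v)\<in>\<pi>. (\<exists>x\<in>W\<^sup>\<bottom>. A *v x \<noteq> x) \<longrightarrow> Q v \<notin> range (\<lambda>x. (A - mat 1) *v x))"
    unfolding split_beta by (metis prod.collapse)
  then show ?thesis
    unfolding no_exceptional_iff Q_def .
qed

subsection \<open>Local trivializations\<close>

text \<open>An element acting trivially on the orthogonal complement commutes with translations
  along it, so an identification of points in one leaf carries over to every parallel leaf.\<close>

lemma trivial_act_add:
  assumes "g \<in> \<pi>" and triv: "\<And>x. Q (act g x) = Q x" and z: "z \<in> W\<^sup>\<bottom>"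
  shows "act g (x + z) = act g x + z"
proof -
  have "Q (snd g) = 0"
    using triv[of 0] Q_act[OF assms(1), of 0] by simp
  then have "fst g *v z = z"
    using triv[of z] Q_act[OF assms(1), of z] z by (simp add: Q_id)
  then show ?thesis
    by (simp add: act_eq matrix_vector_right_distrib)
qed

text \<open>By \<open>finite_mod_lattice\<close>, the transverse displacements of \<open>u\<close>
  below 1 take only finitely many values, so the positive ones stay away from 0.\<close>

lemma displacement_gap:
  obtains e where "e > 0"
    "\<And>g. g \<in> \<pi> \<Longrightarrow> norm (Q (act g u) - Q u) < e \<Longrightarrow> Q (act g u) = Q u"
proof -
  obtain F where F: "finite F" "F \<subseteq> \<pi>"
    \<comment> \<open>A transverse displacement of at most 1 at \<open>u\<close> forces this bound,
      because \<open>Q (snd g)\<close> differs from the displacement by \<open>Q u\<close> and its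
      image under the linear part.\<close>
    "\<And>g. g \<in> \<pi> \<Longrightarrow> norm (Q (snd g)) \<le> 1 + 2 * norm u \<Longrightarrow>
      \<exists>h\<in>F. \<forall>x. Q (act h x) = Q (act g x)"
    using finite_mod_lattice[of "1 + 2 * norm u"] by blast
  define D where "D = (\<lambda>h. norm (Q (act h u) - Q u)) ` F - {0}"
  define e where "e = Min (insert 1 D)"
  have D: "finite D" "\<And>d. d \<in> D \<Longrightarrow> d > 0"
    using F(1) by (auto simp: D_def)
  have "e > 0"
    using D by (simp add: e_def)
  moreover have "Q (act g u) = Q u" if g: "g \<in> \<pi>" and small: "norm (Q (act g u) - Q u) < e" for g
  proof -
    have "e \<le> 1"
      using D by (simp add: e_def)
    have "Q (snd g) = (Q (act g u) - Q u) + Q u - fst g *v Q u"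
      using Q_act[OF g] by simp
    then have "norm (Q (snd g)) \<le> norm (Q (act g u) - Q u) + norm (Q u) + norm (fst g *v Q u)"
      by (metis norm_add_diff_le)
    then have "norm (Q (snd g)) \<le> 1 + 2 * norm u"
      using small \<open>e \<le> 1\<close> norm_Q_le[of u] norm_linear_part[OF g, of "Q u"] by linarith
    then obtain h where h: "h \<in> F" "\<forall>x. Q (act h x) = Q (act g x)"
      using F(3) g by blast
    have "norm (Q (act h u) - Q u) \<notin> D"
    proof
      assume "norm (Q (act h u) - Q u) \<in> D"
      then have "e \<le> norm (Q (act h u) - Q u)"
        using D by (simp add: e_def)
      then show False
        using small h(2) by simp
    qed
    then have "norm (Q (act h u) - Q u) = 0"
      using h(1) unfolding D_def by blast
    then show ?thesis
      using h(2) by simp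
  qed
  ultimately show ?thesis
    using that by blast
qed

lemma continuous_on_Q [continuous_intros]:
  fixes f :: "'a::topological_space \<Rightarrow> real^'n"
  assumes "continuous_on S f"
  shows "continuous_on S (\<lambda>x. Q (f x))"
  using bounded_linear.continuous_on[OF linear_Q[folded linear_linear] assms] .

lemma continuous_on_P [continuous_intros]:
  fixes f :: "'a::topological_space \<Rightarrow> real^'n"
  assumes "continuous_on S f"
  shows "continuous_on S (\<lambda>x. P (f x))"
  using bounded_linear.continuous_on[OF linear_P[folded linear_linear] assms] .

text \<open>The fiber is the leaf through 0. Over a thin tube, \<open>\<Phi>\<close> sends the orbit
  of \<open>t\<close> to the leaf of \<open>t\<close> together with the point of the fiber under
  \<open>P t\<close>; \<open>\<Psi>\<close> recombines a transverse component \<open>Q t\<close>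
  with a tangential component \<open>P z\<close>. Both are independent of representatives because
  the elements relating two of them act trivially in the transverse direction.\<close>

lemma leaf_bundle_if_trivial:
  assumes triv: "\<And>g u x. g \<in> \<pi> \<Longrightarrow> Q (act g u) = Q u \<Longrightarrow> Q (act g x) = Q x"
  shows "leaf_bundle \<pi> W"
proof -
  let ?q = "proj_M \<pi>" and ?b = "leaf \<pi> W" and ?r = "leaf_cover \<pi> W 0" and ?p = "leaf_proj \<pi> W"
  have r: "?r x = ?q (P x)" for x
    by (simp add: leaf_cover_eq)
  have 1: "?p ` range ?q = range ?b"
    by (simp add: image_image)
  have 2: "smooth_map ?q ?b (range ?q) ?p"
    by (rule smooth_map_if_lift) (auto intro!: exI[of _ "\<lambda>x. x"] exI[of _ 0] simp: linear_iff)
  have 3: "\<exists>U \<Phi>. y \<in> U \<and> U \<subseteq> range ?b \<and> open (?b -` U) \<and>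
      diffeo ?q (map_prod ?b ?r) {m \<in> range ?q. ?p m \<in> U} (U \<times> range ?r) \<Phi> \<and>
      (\<forall>m\<in>range ?q. ?p m \<in> U \<longrightarrow> fst (\<Phi> m) = ?p m)" if y: "y \<in> range ?b" for y
  proof -
    obtain a where a: "y = ?b a"
      using y by blast
    obtain e where e: "e > 0"
      "\<And>g. g \<in> \<pi> \<Longrightarrow> norm (Q (act g a) - Q a) < e \<Longrightarrow> Q (act g a) = Q a"
      using displacement_gap by blast
    define tube where "tube = {t. norm (Q t - Q a) < e / 2}"
    have tube_cong: "t \<in> tube \<longleftrightarrow> s \<in> tube" if "Q t = Q s" for t s
      using that by (simp add: tube_def)
    have tube_triv: "Q (act g x) = Q x"
      \<comment> \<open>The radius \<open>e / 2\<close> makes such a \<open>g\<close> move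
        \<open>a\<close> transversally by less than \<open>e\<close>; by the gap it fixes
        \<open>Q a\<close>, hence acts trivially.\<close>
      if "g \<in> \<pi>" "t \<in> tube" "s \<in> tube" "Q (act g t) = Q s" for g t s x
    proof -
      have "Q (act g a) - Q (act g t) = fst g *v (Q a - Q t)"
        unfolding Q_act[OF that(1)] by (simp add: matrix_vector_mult_diff_distrib)
      then have "norm (Q (act g a) - Q (act g t)) < e / 2"
        using that by (simp add: tube_def norm_minus_commute)
      moreover have "norm (Q (act g t) - Q a) < e / 2"
        using that by (simp add: tube_def)
      ultimately have "norm (Q (act g a) - Q a) < e"
        using norm_diff_triangle_less[of "Q (act g a)" "Q (act g t)" "e / 2" "Q a" "e / 2"] by simp
      then show ?thesis
        using e(2) triv that(1) by blast
    qed
    have open_tube: "open {x. act g x \<in> tube}" for g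
      unfolding tube_def mem_Collect_eq
      by (intro open_Collect_less continuous_intros)
    define U where "U = ?b ` tube"
    have in_U: "?b x \<in> U \<longleftrightarrow> (\<exists>g\<in>\<pi>. act g x \<in> tube)" for x
    proof
      assume "?b x \<in> U"
      then obtain t where "t \<in> tube" "?b x = ?b t"
        by (auto simp: U_def)
      then show "\<exists>g\<in>\<pi>. act g x \<in> tube"
        using leaf_eq_iff tube_cong by metis
    next
      assume "\<exists>g\<in>\<pi>. act g x \<in> tube"
      then show "?b x \<in> U"
        using leaf_eqI unfolding U_def by blast
    qed
    let ?D = "{m \<in> range ?q. ?p m \<in> U}" and ?E = "U \<times> range ?r"
    define \<Phi> where "\<Phi> m = (let t = (SOME t. t \<in> tube \<and> ?q t = m) in (?b t, ?r t))" for m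
    define \<Psi> where "\<Psi> c = (let t = (SOME t. t \<in> tube \<and> ?b t = fst c);
        z = (SOME z. ?r z = snd c) in ?q (Q t + P z))" for c
    have \<Phi>: "\<Phi> (?q t) = (?b t, ?r t)" if t: "t \<in> tube" for t
    proof -
      define s where "s = (SOME s. s \<in> tube \<and> ?q s = ?q t)"
      have s: "s \<in> tube" "?q s = ?q t"
        using someI[of "\<lambda>s. s \<in> tube \<and> ?q s = ?q t" t] t by (auto simp: s_def)
      then obtain g where g: "g \<in> \<pi>" "t = act g s"
        using proj_M_eq_iff by blast
      then have gtriv: "Q (act g x) = Q x" for x
        using tube_triv[OF g(1) s(1) t] by simp
      have "?b s = ?b t"
        using leaf_proj_proj_M s(2) by metis
      moreover have "P t = act g (P s)"
        using trivial_act_add[OF g(1) gtriv Q_in, of "P s" s] decomp[of s] decomp[of t]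
          gtriv[of s] g(2) by (metis add_right_cancel)
      then have "?r t = ?r s"
        using g(1) by (simp add: r)
      ultimately show ?thesis
        by (simp add: \<Phi>_def s_def[symmetric])
    qed
    have \<Psi>: "\<Psi> (?b t, ?r z) = ?q (Q t + P z)" if t: "t \<in> tube" for t z
    proof -
      define s where "s = (SOME s. s \<in> tube \<and> ?b s = ?b t)"
      define y where "y = (SOME y. ?r y = ?r z)"
      have s: "s \<in> tube" "?b s = ?b t"
        using someI[of "\<lambda>s. s \<in> tube \<and> ?b s = ?b t" t] t by (auto simp: s_def)
      have y: "?q (P y) = ?q (P z)"
        using someI[of "\<lambda>y. ?r y = ?r z" z] by (simp add: y_def r)
      obtain g where g: "g \<in> \<pi>" "Q (act g s) = Q t"
        using s(2) leaf_eq_iff by blast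
      then have "Q s = Q t"
        using tube_triv[OF g(1) s(1) t g(2)] by metis
      moreover obtain h where h: "h \<in> \<pi>" "P z = act h (P y)"
        using y proj_M_eq_iff by blast
      \<comment> \<open>Both \<open>P y\<close> and its image \<open>P z\<close> lie in
        \<open>W\<close>, so \<open>h\<close> fixes the transverse point 0.\<close>
      have "Q (act h (P y)) = Q (P y)"
        using h(2)[symmetric] by simp
      then have htriv: "Q (act h x) = Q x" for x
        using triv h(1) by blast
      have "act h (P y + Q t) = P z + Q t"
        using trivial_act_add[OF h(1) htriv Q_in, of "P y"] h(2) by simp
      then have "?q (Q t + P y) = ?q (Q t + P z)"
        using h(1) by (metis add.commute proj_M_act)
      ultimately show ?thesis
        by (simp add: \<Psi>_def s_def[symmetric] y_def[symmetric])
    qed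
    have D_tube: "\<exists>t\<in>tube. m = ?q t" if "m \<in> ?D" for m
    proof -
      obtain x where "m = ?q x" "?b x \<in> U"
        using \<open>m \<in> ?D\<close> by auto
      then obtain g where "g \<in> \<pi>" "act g x \<in> tube" "m = ?q x"
        using in_U by blast
      then show ?thesis
        by (intro bexI[of _ "act g x"]) simp_all
    qed
    have tube_D: "?q t \<in> ?D" if "t \<in> tube" for t
      using that by (simp add: U_def)
    have "diffeo ?q (map_prod ?b ?r) ?D ?E \<Phi>"
    proof (rule diffeoI)
      show "smooth_map ?q (map_prod ?b ?r) ?D \<Phi>"
      proof (rule smooth_map_if_lift)
        fix x assume "?q x \<in> ?D"
        then obtain g where g: "g \<in> \<pi>" "act g x \<in> tube"
          using in_U by auto
        have "\<forall>\<^sub>F y in nhds x. act g y \<in> tube"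
          using eventually_nhds_in_open[OF open_tube, of x g] g(2) by simp
        then have "\<forall>\<^sub>F y in nhds x.
            map_prod ?b ?r ((fst g *v y, fst g *v y) + (snd g, snd g)) = \<Phi> (?q y)"
        proof eventually_elim
          case (elim y)
          then show ?case
            using \<Phi>[OF elim] unfolding proj_M_act[OF g(1)] by (simp add: act_eq)
        qed
        moreover have "linear (\<lambda>y. (fst g *v y, fst g *v y))"
          by (simp add: linear_iff matrix_vector_right_distrib matrix_vector_mult_scaleR)
        ultimately show "\<exists>l c. linear l \<and> (\<forall>\<^sub>F y in nhds x. map_prod ?b ?r (l y + c) = \<Phi> (?q y))"
          by blast
      qed
      have near: "\<exists>g\<in>\<pi>. \<forall>\<^sub>F d in nhds c. act g (fst d) \<in> tube" if "map_prod ?b ?r c \<in> ?E" for c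
      proof -
        have "?b (fst c) \<in> U"
          using that by (cases c) simp
        then obtain g where g: "g \<in> \<pi>" "act g (fst c) \<in> tube"
          using in_U by blast
        have "\<forall>\<^sub>F y in nhds (fst c). act g y \<in> tube"
          using eventually_nhds_in_open[OF open_tube, of "fst c" g] g(2) by simp
        moreover have "filterlim fst (nhds (fst c)) (nhds c)"
          by (intro tendsto_fst filterlim_ident)
        ultimately show ?thesis
          using g(1) eventually_compose_filterlim by blast
      qed
      show "smooth_map (map_prod ?b ?r) ?q ?E \<Psi>"
      proof (rule smooth_map_if_lift)
        fix c assume c: "map_prod ?b ?r c \<in> ?E"
        obtain g where g: "g \<in> \<pi>" and ev: "\<forall>\<^sub>F d in nhds c. act g (fst d) \<in> tube"
          using near[OF c] by blast
        from ev have "\<forall>\<^sub>F d in nhds c. ?q ((fst g *v Q (fst d) + P (snd d)) + Q (snd g)) =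
            \<Psi> (map_prod ?b ?r d)"
        proof eventually_elim
          case (elim d)
          have "?b (act g (fst d)) = ?b (fst d)"
            using leaf_proj_proj_M proj_M_act[OF g] by metis
          then have "\<Psi> (map_prod ?b ?r d) = ?q (Q (act g (fst d)) + P (snd d))"
            using \<Psi>[OF elim, of "snd d"] by (cases d) simp
          then show ?case
            by (simp add: Q_act[OF g] algebra_simps)
        qed
        moreover have "linear (\<lambda>d. fst g *v Q (fst d) + P (snd d))"
          by (simp add: linear_iff matrix_vector_right_distrib matrix_vector_mult_scaleR
              scaleR_right_distrib)
        ultimately show "\<exists>l k. linear l \<and> (\<forall>\<^sub>F d in nhds c. ?q (l d + k) = \<Psi> (map_prod ?b ?r d))"
          by blast
      qed
      show "\<forall>\<^sub>F d in nhds c. map_prod ?b ?r d \<in> ?E" if c: "map_prod ?b ?r c \<in> ?E" for c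
      proof -
        obtain g where g: "g \<in> \<pi>" and ev: "\<forall>\<^sub>F d in nhds c. act g (fst d) \<in> tube"
          using near[OF c] by blast
        from ev show ?thesis
        proof eventually_elim
          case (elim d)
          then have "?b (fst d) \<in> U"
            using in_U g by blast
          then show ?case
            by (cases d) simp
        qed
      qed
      show "\<Phi> m \<in> ?E \<and> \<Psi> (\<Phi> m) = m" if m: "m \<in> ?D" for m
      proof -
        obtain t where t: "t \<in> tube" "m = ?q t"
          using D_tube[OF m] by blast
        then show ?thesis
          using \<Phi>[OF t(1)] \<Psi>[OF t(1), of t] decomp[of t] by (simp add: U_def add.commute)
      qed
      show "\<Psi> c \<in> ?D \<and> \<Phi> (\<Psi> c) = c" if c: "c \<in> ?E" for c
      proof -
        obtain t z where t: "t \<in> tube" "c = (?b t, ?r z)"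
          using c by (auto simp: U_def)
        let ?s = "Q t + P z"
        have s: "?s \<in> tube"
          using tube_cong[of ?s t] t(1) by simp
        have "?b ?s = ?b t"
          using leaf_eqI[OF one_closed, of ?s t] by simp
        moreover have "?r ?s = ?r z"
          by (simp add: r)
        ultimately show ?thesis
          using \<Psi>[OF t(1), of z] \<Phi>[OF s] tube_D[OF s] t(2) by simp
      qed
    qed
    moreover have "open (?b -` U)"
    proof -
      have "?b -` U = (\<Union>g\<in>\<pi>. {x. act g x \<in> tube})"
        using in_U by blast
      then show ?thesis
        using open_tube by auto
    qed
    moreover have "fst (\<Phi> m) = ?p m" if m: "m \<in> ?D" for m
    proof -
      obtain t where "t \<in> tube" "m = ?q t"
        using D_tube[OF m] by blast
      then show ?thesis
        using \<Phi> by simp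
    qed
    moreover have "y \<in> U" "U \<subseteq> range ?b"
      using e(1) by (auto simp: U_def a tube_def)
    ultimately show ?thesis
      by blast
  qed
  show ?thesis
    unfolding leaf_bundle_def smooth_fiber_bundle_def
    by (rule exI[of _ 0], intro conjI ballI, rule 1, rule 2, erule 3)
qed

subsection \<open>Isometries between leaves\<close>

text \<open>The shift by \<open>P (u - u')\<close> makes the two representatives differ only in the
  transverse summand, \<open>Q u\<close> against \<open>Q u'\<close>. By
  \<open>trivial_act_add\<close> the same group element identifies points for both.\<close>

lemma leaf_transport:
  assumes triv: "\<And>g u x. g \<in> \<pi> \<Longrightarrow> Q (act g u) = Q u \<Longrightarrow> Q (act g x) = Q x"
    and "leaf_cover \<pi> W u x = leaf_cover \<pi> W u y"
  shows "leaf_cover \<pi> W u' (x + P (u - u')) = leaf_cover \<pi> W u' (y + P (u - u'))"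
proof -
  have eq: "P z + u = (P z + P u) + Q u"
    "P (z + P (u - u')) + u' = (P z + P u) + Q u'" for z
    by (simp_all add: Q_eq)
  obtain g where g: "g \<in> \<pi>" "P y + P u + Q u = act g (P x + P u + Q u)"
    using assms(2) unfolding leaf_cover_eq eq proj_M_eq_iff by blast
  then have "Q (act g (P x + P u + Q u)) = Q (P x + P u + Q u)"
    by (metis Q_simps(1) QP)
  then have gtriv: "Q (act g z) = Q z" for z
    using triv g(1) by blast
  have "P y + P u + Q u' = act g (P x + P u + Q u')"
    using g(2) trivial_act_add[OF g(1) gtriv Q_in] by (metis add_right_cancel)
  then show ?thesis
    unfolding leaf_cover_eq eq proj_M_eq_iff using g(1) by blast
qed

lemma isometric_leaves_if_trivial:
  assumes triv: "\<And>g u x. g \<in> \<pi> \<Longrightarrow> Q (act g u) = Q u \<Longrightarrow> Q (act g x) = Q x"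
  shows "isometric_leaves \<pi> W u u'"
proof -
  \<comment> \<open>The map induced by a translation along \<open>W\<close>, whose derivative is the
    identity; \<open>leaf_transport\<close> makes the preimage picked by \<open>inv_into\<close>
    irrelevant.\<close>
  let ?T = "\<lambda>u u' m. leaf_cover \<pi> W u' (inv_into UNIV (leaf_cover \<pi> W u) m + P (u - u'))"
  have T: "?T u u' (leaf_cover \<pi> W u x) = leaf_cover \<pi> W u' (x + P (u - u'))" for u u' x
    by (rule leaf_transport) (fact triv, rule f_inv_into_f, rule rangeI)
  have smooth: "smooth_map (leaf_cover \<pi> W u) (leaf_cover \<pi> W u') D (?T u u')" for u u' D
    by (rule smooth_map_if_lift) (use T in \<open>auto intro!: exI[of _ "\<lambda>x. x"] exI[of _ "P (u - u')"] simp: linear_iff\<close>)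
  have inverse: "?T u u' m \<in> leaf \<pi> W u' \<and> ?T u' u (?T u u' m) = m" if m: "m \<in> leaf \<pi> W u" for u u' m
  proof -
    obtain x where "m = leaf_cover \<pi> W u x"
      using m range_leaf_cover[of u] by blast
    then show ?thesis
      using range_leaf_cover[of u'] T by auto
  qed
  have diffeo: "diffeo (leaf_cover \<pi> W u) (leaf_cover \<pi> W u') (leaf \<pi> W u) (leaf \<pi> W u') (?T u u')"
  proof (rule diffeoI[where h' = "?T u' u"])
    have "leaf_cover \<pi> W u' z \<in> leaf \<pi> W u'" for z
      using range_leaf_cover[of u'] by blast
    then show "\<forall>\<^sub>F z in nhds y. leaf_cover \<pi> W u' z \<in> leaf \<pi> W u'" for y
      by simp
  qed (fact smooth inverse)+
  let ?g = "\<lambda>x. x + P (u - u')"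
  have smooth_g: "smooth_on UNIV ?g"
    by (rule smooth_on_affine) (simp add: linear_iff)
  have deriv_g: "frechet_derivative ?g (at y) = (\<lambda>x. x)" for y
    by (rule frechet_derivative_at[symmetric]) (rule has_derivative_add_const has_derivative_ident)+
  show ?thesis
    unfolding isometric_leaves_def
  proof (intro exI[of _ "?T u u'"] conjI allI diffeo exI[of _ UNIV] exI[of _ ?g] ballI)
    show "leaf_cover \<pi> W u' (?g y) = ?T u u' (leaf_cover \<pi> W u y)" for y
      by (rule T[symmetric])
    show "norm (orth_proj W (frechet_derivative ?g (at y) \<xi>)) = norm (orth_proj W \<xi>)" for y \<xi>
      by (simp only: deriv_g)
  qed (simp_all add: smooth_g del: P_simps)
qed

text \<open>Both the isometry and its inverse lift to the level sets of \<open>Q\<close>. Uniqueness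
  of lifts makes the composite equal to \<open>x \<mapsto> P x + u\<close>, which gives injectivity
  on \<open>W\<close>; the metric condition bounds the derivative by 1, and the mean value
  inequality gives the Lipschitz estimate.\<close>

lemma leaf_isometry_lift:
  assumes "isometric_leaves \<pi> W u u'"
  obtains T where "\<And>x y. norm (T x - T y) \<le> norm (x - y)" "\<And>x. T x \<in> W" "inj_on T W"
    "\<And>x y. leaf_cover \<pi> W u x = leaf_cover \<pi> W u y \<Longrightarrow>
       leaf_cover \<pi> W u' (T x) = leaf_cover \<pi> W u' (T y)"
proof -
  obtain \<phi> where
    \<phi>: "diffeo (leaf_cover \<pi> W u) (leaf_cover \<pi> W u') (leaf \<pi> W u) (leaf \<pi> W u') \<phi>" and
    loc: "\<And>x. \<exists>V g. open V \<and> x \<in> V \<and> smooth_on V g \<and>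
        (\<forall>y\<in>V. leaf_cover \<pi> W u' (g y) = \<phi> (leaf_cover \<pi> W u y)) \<and>
        (\<forall>y\<in>V. \<forall>\<xi>. norm (orth_proj W (frechet_derivative g (at y) \<xi>)) = norm (orth_proj W \<xi>))"
    using assms unfolding isometric_leaves_def by blast
  define \<psi> where "\<psi> = inv_into (leaf \<pi> W u) \<phi>"
  have bij: "bij_betw \<phi> (leaf \<pi> W u) (leaf \<pi> W u')"
    and smooth_\<psi>: "smooth_map (leaf_cover \<pi> W u') (leaf_cover \<pi> W u) (leaf \<pi> W u') \<psi>"
    using \<phi> by (simp_all add: diffeo_def \<psi>_def)
  have \<psi>\<phi>: "\<psi> (\<phi> (leaf_cover \<pi> W u x)) = leaf_cover \<pi> W u x" for x
    unfolding \<psi>_def using bij range_leaf_cover[of u]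
    by (intro inv_into_f_f) (auto simp: bij_betw_def)
  have stab: "act g ` {x. Q x = Q u} \<subseteq> {x. Q x = Q u}"
    if "g \<in> \<pi>" "x \<in> {x. Q x = Q u}" "act g x \<in> {x. Q x = Q u}" for g x u
  proof (rule image_subsetI)
    fix y assume "y \<in> {x. Q x = Q u}"
    then have "Q (act g y) = Q (act g x)"
      using that by (intro Q_act_cong) simp_all
    then show "act g y \<in> {x. Q x = Q u}"
      using that by simp
  qed
  have local: "\<exists>V h. open V \<and> x \<in> V \<and> continuous_on V h \<and>
      (\<forall>y\<in>V. h y \<in> {x. Q x = Q u} \<and> proj_M \<pi> (h y) = f y)"
    if V: "open V" "x \<in> V" "smooth_on V g" and g: "\<And>y. y \<in> V \<Longrightarrow> leaf_cover \<pi> W u (g y) = f y"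
    for V :: "(real^'n) set" and x g u f
  proof (intro exI conjI ballI)
    show "continuous_on V (\<lambda>y. P (g y) + u)"
      by (intro continuous_intros smooth_on_imp_continuous_on V)
  qed (use V g in \<open>simp_all add: leaf_cover_eq\<close>)

  obtain V\<^sub>0 g\<^sub>0 where "(0::real^'n) \<in> V\<^sub>0"
    "\<forall>y\<in>V\<^sub>0. leaf_cover \<pi> W u' (g\<^sub>0 y) = \<phi> (leaf_cover \<pi> W u y)"
    using loc[of 0] by blast
  then have start: "proj_M \<pi> (P (g\<^sub>0 0) + u') = \<phi> (leaf_cover \<pi> W u 0)"
    by (simp add: leaf_cover_eq)
  obtain T where T: "continuous_on UNIV T" "\<And>x. Q (T x) = Q u'"
    "\<And>x. proj_M \<pi> (T x) = \<phi> (leaf_cover \<pi> W u x)"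
  proof (rule lift_exists[of "{x. Q x = Q u'}" "\<lambda>x. \<phi> (leaf_cover \<pi> W u x)" "P (g\<^sub>0 0) + u'" 0])
    show "\<exists>V h. open V \<and> x \<in> V \<and> continuous_on V h \<and>
        (\<forall>y\<in>V. h y \<in> {x. Q x = Q u'} \<and> proj_M \<pi> (h y) = \<phi> (leaf_cover \<pi> W u y))" for x
      using loc[of x] local by (elim exE conjE) (rule local, auto)
  qed (use start stab in auto)
  have in_W: "T x - u' \<in> W" for x
    using T(2)[of x] by (simp flip: Q_eq_0_iff)
  have cover_T: "leaf_cover \<pi> W u' (T x - u') = \<phi> (leaf_cover \<pi> W u x)" for x
    using T(3)[of x] P_id[OF in_W[of x]] by (simp add: leaf_cover_eq)

  obtain S where S: "continuous_on UNIV S" "S (T 0 - u') = u"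
    "\<And>y. proj_M \<pi> (S y) = \<psi> (leaf_cover \<pi> W u' y)"
  proof (rule lift_exists[of "{x. Q x = Q u}" "\<lambda>y. \<psi> (leaf_cover \<pi> W u' y)" u "T 0 - u'"])
    show "\<exists>V h. open V \<and> x \<in> V \<and> continuous_on V h \<and>
        (\<forall>y\<in>V. h y \<in> {x. Q x = Q u} \<and> proj_M \<pi> (h y) = \<psi> (leaf_cover \<pi> W u' y))" for x
    proof -
      have "leaf_cover \<pi> W u' x \<in> leaf \<pi> W u'"
        using range_leaf_cover[of u'] by blast
      then obtain V g where "open V" "x \<in> V" "smooth_on V g"
        "\<forall>y\<in>V. leaf_cover \<pi> W u (g y) = \<psi> (leaf_cover \<pi> W u' y)"
        using smooth_\<psi> unfolding smooth_map_def by blast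
      then show ?thesis
        by (intro local) auto
    qed
    show "proj_M \<pi> u = \<psi> (leaf_cover \<pi> W u' (T 0 - u'))"
      unfolding cover_T \<psi>\<phi> by (simp add: leaf_cover_eq)
  qed (use stab in auto)
  have ST: "S (T x - u') = P x + u" for x
  proof (rule lifts_agree[where k = "\<lambda>x. S (T x - u')" and l = "\<lambda>x. P x + u" and a = 0])
    show "continuous_on UNIV (\<lambda>x. S (T x - u'))"
      using T(1) by (intro continuous_on_compose2[OF S(1)] continuous_intros) auto
    show "continuous_on UNIV (\<lambda>x. P x + u)"
      by (intro continuous_intros)
    show "proj_M \<pi> (S (T x - u')) = proj_M \<pi> (P x + u)" for x
      unfolding S(3) cover_T \<psi>\<phi> by (simp add: leaf_cover_eq)
    show "S (T 0 - u') = P 0 + u"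
      by (simp add: S(2))
  qed

  have deriv: "\<exists>D. (T has_derivative D) (at x) \<and> (\<forall>\<xi>. norm (D \<xi>) \<le> norm \<xi>)" for x
  proof -
    obtain V g where V: "open V" "x \<in> V" "smooth_on V g"
      and g: "\<And>y. y \<in> V \<Longrightarrow> leaf_cover \<pi> W u' (g y) = \<phi> (leaf_cover \<pi> W u y)"
      and norm_g: "\<And>\<xi>. norm (P (frechet_derivative g (at x) \<xi>)) = norm (P \<xi>)"
      using loc[of x] unfolding P_def by blast
    have "proj_M \<pi> (T y) = proj_M \<pi> (P (g y) + u')" if "y \<in> V" for y
      using T(3)[of y] g[OF that] by (simp add: leaf_cover_eq)
    \<comment> \<open>The group element \<open>k\<close> corrects the local smooth lift so that it
      agrees with \<open>T\<close> at \<open>x\<close>; by \<open>sep\<close> the two then agree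
      near \<open>x\<close>, and \<open>T\<close> inherits the derivative.\<close>
    then obtain k where k: "k \<in> \<pi>" "T x = act k (P (g x) + u')"
      and orbit: "\<And>y. y \<in> V \<Longrightarrow> proj_M \<pi> (T y) = proj_M \<pi> (act k (P (g y) + u'))"
      using proj_M_eq_iff V(2) by (metis proj_M_act)
    let ?h = "\<lambda>y. act k (P (g y) + u')"
    have h_eq: "?h = (\<lambda>y. fst k *v P (g y) + (fst k *v u' + snd k))"
      by (simp add: act_eq matrix_vector_right_distrib add.assoc)
    have "(g has_derivative frechet_derivative g (at x)) (at x)"
      using smooth_on_imp_differentiable[OF V(3,2)] by (simp add: frechet_derivative_works)
    then have deriv_h: "(?h has_derivative (\<lambda>\<xi>. fst k *v P (frechet_derivative g (at x) \<xi>))) (at x)"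
      unfolding h_eq
      by (intro has_derivative_add_const bounded_linear.has_derivative[OF matrix_vector_mul_bounded_linear]
          bounded_linear.has_derivative[OF linear_P[folded linear_linear]])
    have "continuous_on V (\<lambda>y. T y - ?h y)"
      by (intro continuous_intros smooth_on_imp_continuous_on V continuous_on_subset[OF T(1)]) auto
    then have "open (V \<inter> (\<lambda>y. T y - ?h y) -` ball 0 sep)"
      using V(1) by (intro continuous_open_preimage) auto
    moreover have "x \<in> V \<inter> (\<lambda>y. T y - ?h y) -` ball 0 sep"
      using V(2) k(2) sep_pos by simp
    moreover have "?h y = T y" if "y \<in> V \<inter> (\<lambda>y. T y - ?h y) -` ball 0 sep" for y
      using that orbit[of y] proj_M_inj_near[of "T y" "?h y"] by simp
    ultimately have "(T has_derivative (\<lambda>\<xi>. fst k *v P (frechet_derivative g (at x) \<xi>))) (at x)"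
      by (rule has_derivative_transform_within_open[OF deriv_h])
    moreover have "norm (fst k *v P (frechet_derivative g (at x) \<xi>)) \<le> norm \<xi>" for \<xi>
      unfolding norm_linear_part[OF k(1)] norm_g by (rule norm_P_le)
    ultimately show ?thesis
      by blast
  qed
  then obtain D where D: "\<And>x. (T has_derivative D x) (at x)" "\<And>x \<xi>. norm (D x \<xi>) \<le> norm \<xi>"
    by metis
  have lipschitz: "norm (T x - T y) \<le> norm (x - y)" for x y
  proof -
    have "onorm (D z) \<le> 1" for z
      using D(2)[of z] by (intro onorm_le) simp
    then have "norm (T x - T y) \<le> 1 * norm (x - y)"
      using D(1) by (intro differentiable_bound[of UNIV T D]) auto
    then show ?thesis
      by simp
  qed

  show ?thesis
  proof (rule that[of "\<lambda>x. T x - u'"])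
    show "norm ((T x - u') - (T y - u')) \<le> norm (x - y)" for x y
      using lipschitz by simp
    show "inj_on (\<lambda>x. T x - u') W"
    proof (rule inj_onI)
      fix x y assume xy: "x \<in> W" "y \<in> W" "T x - u' = T y - u'"
      have "P x + u = P y + u"
        unfolding ST[symmetric] xy(3) ..
      then show "x = y"
        by (simp add: P_id[OF xy(1)] P_id[OF xy(2)])
    qed
    show "leaf_cover \<pi> W u' (T x - u') = leaf_cover \<pi> W u' (T y - u')"
      if "leaf_cover \<pi> W u x = leaf_cover \<pi> W u y" for x y
      unfolding cover_T that ..
  qed (rule in_W)
qed

subsection \<open>Counting short loops in leaves\<close>

text \<open>For \<open>x\<close> in \<open>W\<close>, these are the endpoints of the lifts starting
  at \<open>x\<close> of geodesic loops of length at most \<open>R\<close> in the leaf, the constant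
  loop included when \<open>R\<close> is nonnegative.\<close>

definition near_orbit :: "real^'n \<Rightarrow> real \<Rightarrow> real^'n \<Rightarrow> (real^'n) set" where
  "near_orbit u R x = {y \<in> W. leaf_cover \<pi> W u y = leaf_cover \<pi> W u x \<and> norm (y - x) \<le> R}"

lemma leaf_cover_eq_iff:
  assumes "x \<in> W" "y \<in> W"
  shows "leaf_cover \<pi> W u y = leaf_cover \<pi> W u x \<longleftrightarrow> (\<exists>g\<in>\<pi>. act g (x + u) = y + u)"
  unfolding leaf_cover_eq P_id[OF assms(1)] P_id[OF assms(2)]
  using proj_M_eq_iff[of "x + u" "y + u"] by metis

lemma near_orbit_subset:
  assumes "x \<in> W"
  shows "near_orbit u R x \<subseteq> (\<lambda>g. act g (x + u) - u) ` {g \<in> \<pi>. norm (act g (x + u) - (x + u)) \<le> R}"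
proof
  fix y assume "y \<in> near_orbit u R x"
  then have y: "y \<in> W" "leaf_cover \<pi> W u y = leaf_cover \<pi> W u x" "norm (y - x) \<le> R"
    by (simp_all add: near_orbit_def)
  then obtain g where "g \<in> \<pi>" "act g (x + u) = y + u"
    using leaf_cover_eq_iff[OF assms] by blast
  then show "y \<in> (\<lambda>g. act g (x + u) - u) ` {g \<in> \<pi>. norm (act g (x + u) - (x + u)) \<le> R}"
    using y(3) by (intro image_eqI[of _ _ g]) simp_all
qed

lemma finite_near_orbit: "x \<in> W \<Longrightarrow> finite (near_orbit u R x)"
  using finite_subset[OF near_orbit_subset] finite_moving by blast

text \<open>A lattice translation carries \<open>x\<close> to a bounded region without losing loops.
  There, an element moving the base point by at most \<open>R\<close> moves 0 by a bounded amount,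
  and only finitely many do.\<close>

lemma near_orbit_bounded: "\<exists>N. \<forall>x\<in>W. card (near_orbit u R x) \<le> N"
proof -
  obtain R0 where R0: "\<And>z. z \<in> W \<Longrightarrow> \<exists>l\<in>W. (mat 1, l) \<in> \<pi> \<and> norm (z + l) \<le> R0"
    using lattice_cobounded by blast
  define B where "B = {g \<in> \<pi>. norm (act g 0 - 0) \<le> R + 2 * (R0 + norm u)}"
  have "finite B"
    unfolding B_def by (rule finite_moving)
  have "card (near_orbit u R x) \<le> card B" if x: "x \<in> W" for x
  proof -
    obtain l where l: "l \<in> W" "(mat 1, l) \<in> \<pi>" "norm (x + l) \<le> R0"
      using R0[OF x] by blast
    let ?z = "x + l + u"
    have z: "x + l \<in> W"
      using subspace_add[OF subspace_W x l(1)] .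
    have shift: "leaf_cover \<pi> W u (y + l) = leaf_cover \<pi> W u y" if "y \<in> W" for y
      using leaf_cover_eq_iff[OF that subspace_add[OF subspace_W that l(1)]] l(2) by force
    have "(\<lambda>y. y + l) ` near_orbit u R x \<subseteq> near_orbit u R (x + l)"
      using shift x l(1) by (auto simp: near_orbit_def intro: subspace_add[OF subspace_W])
    then have "card (near_orbit u R x) \<le> card (near_orbit u R (x + l))"
      by (intro card_inj_on_le[of "\<lambda>y. y + l"] finite_near_orbit z) (auto intro: inj_onI)
    also have "\<dots> \<le> card {g \<in> \<pi>. norm (act g ?z - ?z) \<le> R}"
      by (rule surj_card_le[OF finite_moving near_orbit_subset[OF z]])
    also have "\<dots> \<le> card B"
    proof (intro card_mono \<open>finite B\<close> subsetI)
      fix g assume "g \<in> {g \<in> \<pi>. norm (act g ?z - ?z) \<le> R}"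
      then have g: "g \<in> \<pi>" "norm (act g ?z - ?z) \<le> R"
        by simp_all
      have "act g 0 - 0 = (act g ?z - ?z) + ?z - (act g ?z - act g 0)"
        by simp
      then have "norm (act g 0 - 0) \<le> norm (act g ?z - ?z) + norm ?z + norm (act g ?z - act g 0)"
        by (metis norm_add_diff_le)
      then have "norm (act g 0 - 0) \<le> R + 2 * norm ?z"
        using g norm_act_diff[OF g(1), of ?z 0] by simp
      moreover have "norm ?z \<le> R0 + norm u"
        using norm_triangle_ineq[of "x + l" u] l(3) by linarith
      ultimately show "g \<in> B"
        using g(1) by (simp add: B_def)
    qed
    finally show ?thesis .
  qed
  then show ?thesis
    by blast
qed

text \<open>Only finitely many elements matter modulo the lattice, and one that moves \<open>a\<close> fixes at most
  one point of the segment from \<open>a\<close> to \<open>b\<close>.\<close>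

lemma smaller_leaf_group:
  assumes g0: "g0 \<in> \<pi>" "Q (act g0 a) = a" "Q (act g0 b) \<noteq> b" and a: "a \<in> W\<^sup>\<bottom>" and b: "b \<in> W\<^sup>\<bottom>"
  obtains c where "c \<in> W\<^sup>\<bottom>" "Q (act g0 c) \<noteq> c"
    "\<And>h. h \<in> \<pi> \<Longrightarrow> Q (act h c) = c \<Longrightarrow> Q (act h a) = a"
proof -
  define c where "c t = (1 - t) *\<^sub>R a + t *\<^sub>R b" for t :: real
  define d where "d h x = Q (act h x) - x" for h x
  have c_in: "c t \<in> W\<^sup>\<bottom>" for t
    unfolding c_def using a b
    by (intro subspace_add subspace_scale subspace_orthogonal_comp)
  \<comment> \<open>The transverse displacement is affine along the segment, so two zeros on it
    would force it to vanish at \<open>a\<close> as well.\<close>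
  have d_c: "d h (c t) = (1 - t) *\<^sub>R d h a + t *\<^sub>R d h b" if "h \<in> \<pi>" for h t
    using that a b c_in[of t]
    by (simp add: d_def Q_act Q_id c_def matrix_vector_right_distrib matrix_vector_mult_scaleR
        algebra_simps)
  \<comment> \<open>An element fixing a point \<open>c t\<close> of the segment has
    \<open>Q (snd h) = c t - fst h *v c t\<close>, of norm at most \<open>r\<close>, so
    \<open>F\<close> represents all possible stabilizers.\<close>
  define r where "r = 2 * (norm a + norm b)"
  obtain F where F: "finite F" "F \<subseteq> \<pi>"
    "\<And>g. g \<in> \<pi> \<Longrightarrow> norm (Q (snd g)) \<le> r \<Longrightarrow> \<exists>h\<in>F. \<forall>x. Q (act h x) = Q (act g x)"
    using finite_mod_lattice[of r] by blast
  define bad where "bad = (\<Union>h\<in>{h \<in> F. d h a \<noteq> 0}. {t. d h (c t) = 0})"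
  have "finite bad"
    unfolding bad_def
  proof (intro finite_UN_I)
    fix h assume "h \<in> {h \<in> F. d h a \<noteq> 0}"
    then have h: "h \<in> \<pi>" "d h a \<noteq> 0"
      using F(2) by auto
    have "s = t" if "d h (c s) = 0" "d h (c t) = 0" for s t
    proof (rule ccontr)
      assume "s \<noteq> t"
      have "(s - t) *\<^sub>R (d h b - d h a) = d h (c s) - d h (c t)"
        unfolding d_c[OF h(1)] by (simp add: algebra_simps)
      then have "d h b = d h a"
        using that \<open>s \<noteq> t\<close> by simp
      then show False
        using that(1) h(2) unfolding d_c[OF h(1)] by (simp flip: scaleR_left_distrib)
    qed
    then have "\<exists>s. {t. d h (c t) = 0} \<subseteq> {s}"
      by blast
    then show "finite {t. d h (c t) = 0}"
      using finite_subset by blast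
  qed (use F(1) in simp)
  then have "infinite ({0<..<1} - bad)"
    by (intro Diff_infinite_finite \<open>finite bad\<close>) simp
  then have "{0<..<1} - bad \<noteq> {}"
    by (rule infinite_imp_nonempty)
  then obtain t where "t \<in> {0<..<1} - bad"
    by blast
  then have t: "0 < t" "t < 1" "t \<notin> bad"
    by simp_all
  show ?thesis
  proof (rule that[of "c t"])
    show "c t \<in> W\<^sup>\<bottom>"
      by (rule c_in)
    have "d g0 a = 0" "d g0 b \<noteq> 0"
      using g0 by (simp_all add: d_def)
    then have "d g0 (c t) \<noteq> 0"
      using d_c[OF g0(1), of t] t(1) by simp
    then show "Q (act g0 (c t)) \<noteq> c t"
      by (simp add: d_def)
    show "Q (act h a) = a" if h: "h \<in> \<pi>" "Q (act h (c t)) = c t" for h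
    proof -
      have "Q (snd h) = c t - fst h *v c t"
        using h(2) unfolding Q_act[OF h(1)] Q_id[OF c_in] by (simp add: eq_diff_eq add.commute)
      then have "norm (Q (snd h)) \<le> 2 * norm (c t)"
        using norm_triangle_ineq4[of "c t" "fst h *v c t"] h(1) by simp
      moreover have "norm (c t) \<le> norm a + norm b"
        unfolding c_def using t
        by (intro norm_triangle_le add_mono) (simp_all add: mult_left_le_one_le)
      ultimately have "norm (Q (snd h)) \<le> r"
        by (simp add: r_def)
      then obtain k where k: "k \<in> F" "\<And>x. Q (act k x) = Q (act h x)"
        using F(3) h(1) by blast
      then have "d k (c t) = 0"
        using h(2) by (simp add: d_def)
      then have "d k a = 0"
        using t(3) k(1) unfolding bad_def by blast
      then show ?thesis
        using k(2) by (simp add: d_def)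
    qed
  qed
qed

text \<open>Stabilizers of \<open>c\<close> also stabilize \<open>a\<close> and act identically on
  the \<open>W\<close>-component, which gives inclusion. The element \<open>g0\<close>, adjusted by
  a lattice translation to be short, produces a loop over \<open>a\<close>; freeness of the action
  excludes any other element producing it over \<open>c\<close>.\<close>

lemma near_orbit_psubset:
  assumes R: "\<And>z. z \<in> W \<Longrightarrow> \<exists>l\<in>W. (mat 1, l) \<in> \<pi> \<and> norm (z + l) \<le> R"
    and g0: "g0 \<in> \<pi>" "Q (act g0 a) = a" "Q (act g0 c) \<noteq> c" and a: "a \<in> W\<^sup>\<bottom>" and c: "c \<in> W\<^sup>\<bottom>"
    and le: "\<And>h. h \<in> \<pi> \<Longrightarrow> Q (act h c) = c \<Longrightarrow> Q (act h a) = a"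
    and x: "x \<in> W"
  shows "near_orbit c R x \<subset> near_orbit a R x"
proof -
  have Qx: "Q x = 0"
    using x Q_eq_0_iff by blast
  have P_perp: "P z = 0" if "z \<in> W\<^sup>\<bottom>" for z
    using PQ[of z] that by (simp add: Q_id)
  have transfer: "act h (x + a) = y + a \<and> Q (act h c) = c"
    if h: "h \<in> \<pi>" "act h (x + c) = y + c" and y: "y \<in> W" for h y
  proof -
    have Qy: "Q y = 0"
      using y Q_eq_0_iff by blast
    have "Q (act h c) = Q (act h (x + c))"
      by (rule Q_act_cong[OF h(1)]) (simp add: Qx)
    then have fix_c: "Q (act h c) = c"
      using h(2) Qy c by (simp add: Q_id)
    have "Q (act h (x + a)) = Q (act h a)"
      by (rule Q_act_cong[OF h(1)]) (simp add: Qx)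
    then have "Q (act h (x + a)) = a"
      using le[OF h(1) fix_c] by simp
    moreover have "P (act h (x + a)) = P (act h (x + c))"
      unfolding P_act[OF h(1)] using P_perp[OF a] P_perp[OF c] by simp
    then have "P (act h (x + a)) = y"
      using h(2) P_perp[OF c] P_id[OF y] by simp
    ultimately show ?thesis
      using decomp[of "act h (x + a)"] fix_c by simp
  qed
  have "near_orbit c R x \<subseteq> near_orbit a R x"
  proof
    fix y assume "y \<in> near_orbit c R x"
    then have y: "y \<in> W" "leaf_cover \<pi> W c y = leaf_cover \<pi> W c x" "norm (y - x) \<le> R"
      by (simp_all add: near_orbit_def)
    then obtain h where "h \<in> \<pi>" "act h (x + c) = y + c"
      using leaf_cover_eq_iff[OF x y(1)] by blast
    then have "leaf_cover \<pi> W a y = leaf_cover \<pi> W a x"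
      using leaf_cover_eq_iff[OF x y(1)] transfer y(1) by blast
    then show "y \<in> near_orbit a R x"
      using y by (simp add: near_orbit_def)
  qed
  moreover have "\<exists>y. y \<in> near_orbit a R x \<and> y \<notin> near_orbit c R x"
  proof -
    let ?z = "P (act g0 (x + a))"
    have "Q (act g0 (x + a)) = Q (act g0 a)"
      by (rule Q_act_cong[OF g0(1)]) (simp add: Qx)
    then have z: "act g0 (x + a) = ?z + a"
      using decomp[of "act g0 (x + a)"] g0(2) by simp
    have "?z - x \<in> W"
      by (intro subspace_diff subspace_W x) simp
    then obtain l where l: "l \<in> W" "(mat 1, l) \<in> \<pi>" "norm (?z - x + l) \<le> R"
      using R by blast
    let ?g = "(mat 1, l) \<otimes>\<^bsub>Iso\<^esub> g0"
    let ?y = "?z + l"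
    have g: "?g \<in> \<pi>" "act ?g (x + a) = ?y + a"
      using mult_closed[OF l(2) g0(1)] z by (simp_all add: act_mult algebra_simps)
    have y: "?y \<in> W"
      by (intro subspace_add subspace_W l) simp
    have "?y \<in> near_orbit a R x"
      using y g l(3) leaf_cover_eq_iff[OF x y] unfolding near_orbit_def
      by (auto simp: algebra_simps)
    moreover have "?y \<notin> near_orbit c R x"
    proof
      assume "?y \<in> near_orbit c R x"
      then obtain h where h: "h \<in> \<pi>" "act h (x + c) = ?y + c"
        using leaf_cover_eq_iff[OF x y] unfolding near_orbit_def by blast
      \<comment> \<open>Transferred to \<open>a\<close>, the elements \<open>h\<close> and
        \<open>?g\<close> agree at \<open>x + a\<close>; then \<open>g0\<close> would fix
        \<open>c\<close>.\<close>
      then have "h = ?g"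
        using transfer[OF h y] g free2[OF h(1) g(1), of "x + a"] by simp
      then have "Q (act ?g c) = c"
        using transfer[OF h y] by simp
      moreover have "Q l = 0"
        using l(1) Q_eq_0_iff by blast
      ultimately show False
        using g0(3) by (simp add: act_mult)
    qed
    ultimately show ?thesis
      by blast
  qed
  ultimately show ?thesis
    by blast
qed

lemma no_exceptional_if_isometric:
  assumes iso: "\<And>u u'. isometric_leaves \<pi> W u u'"
    and g: "g \<in> \<pi>" "Q (act g u) = Q u"
  shows "Q (act g u') = Q u'"
proof (rule ccontr)
  assume neq: "Q (act g u') \<noteq> Q u'"
  obtain c where c: "c \<in> W\<^sup>\<bottom>" "Q (act g c) \<noteq> c"
    "\<And>h. h \<in> \<pi> \<Longrightarrow> Q (act h c) = c \<Longrightarrow> Q (act h (Q u)) = Q u"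
  proof (rule smaller_leaf_group)
    show "Q (act g (Q u)) = Q u" "Q (act g (Q u')) \<noteq> Q u'"
      using g neq by (simp_all only: Q_act_Q not_False_eq_True)
  qed (use g in auto)
  obtain R where R: "\<And>z. z \<in> W \<Longrightarrow> \<exists>l\<in>W. (mat 1, l) \<in> \<pi> \<and> norm (z + l) \<le> R"
    using lattice_cobounded by blast
  obtain N where N: "\<And>x. x \<in> W \<Longrightarrow> card (near_orbit c R x) \<le> N"
    using near_orbit_bounded by blast
  \<comment> \<open>Bounded natural numbers attain a maximum; \<open>Suc N\<close> turns the bound
    into the strict one required.\<close>
  have "\<exists>x. x \<in> W \<and> (\<forall>y. y \<in> W \<longrightarrow> card (near_orbit c R y) \<le> card (near_orbit c R x))"
    by (rule ex_has_greatest_nat[of _ 0 _ "Suc N"]) (simp_all add: N less_Suc_eq_le subspace_0[OF subspace_W])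
  then obtain x where x: "x \<in> W" "\<And>y. y \<in> W \<Longrightarrow> card (near_orbit c R y) \<le> card (near_orbit c R x)"
    by blast
  obtain T where T: "\<And>x y. norm (T x - T y) \<le> norm (x - y)" "\<And>x. T x \<in> W" "inj_on T W"
    "\<And>x y. leaf_cover \<pi> W (Q u) x = leaf_cover \<pi> W (Q u) y \<Longrightarrow>
       leaf_cover \<pi> W c (T x) = leaf_cover \<pi> W c (T y)"
    using leaf_isometry_lift[OF iso] by blast
  have "near_orbit c R x \<subset> near_orbit (Q u) R x"
    using g c by (intro near_orbit_psubset[OF R] x(1)) (simp_all only: Q_act_Q Q_in)
  then have "card (near_orbit c R x) < card (near_orbit (Q u) R x)"
    by (intro psubset_card_mono finite_near_orbit x(1))
  also have "\<dots> \<le> card (near_orbit c R (T x))"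
  proof (rule card_inj_on_le)
    show "inj_on T (near_orbit (Q u) R x)"
      using T(3) by (rule inj_on_subset) (auto simp: near_orbit_def)
    show "T ` near_orbit (Q u) R x \<subseteq> near_orbit c R (T x)"
    proof (rule image_subsetI)
      fix y assume "y \<in> near_orbit (Q u) R x"
      then have "leaf_cover \<pi> W (Q u) y = leaf_cover \<pi> W (Q u) x" "norm (y - x) \<le> R"
        by (simp_all add: near_orbit_def)
      then show "T y \<in> near_orbit c R (T x)"
        using T(4) T(2) order_trans[OF T(1)] unfolding near_orbit_def by blast
    qed
  qed (intro finite_near_orbit T(2))
  also have "\<dots> \<le> card (near_orbit c R x)"
    using x(2) T(2) by blast
  finally show False
    by simp
qed

end

theorem theoremB:
  fixes \<pi> :: "'n::finite rigid set" and W :: "(real^'n) set"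
  assumes "bieberbach \<pi>"
    and "subspace W"
    and "invariant_under (holonomy \<pi>) W"
    and "generated_by_lattice (lattice_of \<pi>) W"
  shows "(leaf_space_smooth \<pi> W \<and> leaf_bundle \<pi> W
            \<longleftrightarrow> (\<forall>u u'. isometric_leaves \<pi> W u u'))
       \<and> ((\<forall>u u'. isometric_leaves \<pi> W u u')
            \<longleftrightarrow> (\<forall>u. \<not> exceptional \<pi> W u))
       \<and> ((\<forall>u. \<not> exceptional \<pi> W u)
            \<longleftrightarrow> (\<forall>(A, v)\<in>\<pi>. (\<exists>x\<in>W\<^sup>\<bottom>. A *v x \<noteq> x) \<longrightarrow>
                   orth_proj (W\<^sup>\<bottom>) v \<notin> range (\<lambda>x. (A - mat 1) *v x)))"
proof -
  interpret subspace_foliation \<pi> W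
    using assms by unfold_locales
  have iso: "(\<forall>u u'. isometric_leaves \<pi> W u u') \<longleftrightarrow> (\<forall>u. \<not> exceptional \<pi> W u)"
    unfolding no_exceptional_iff
    using isometric_leaves_if_trivial no_exceptional_if_isometric by (intro iffI allI ballI impI) blast+
  \<comment> \<open>Smoothness of the leaf space is equivalent to the absence of exceptional leaves,
    and that absence yields the bundle.\<close>
  moreover have "leaf_space_smooth \<pi> W \<and> leaf_bundle \<pi> W \<longleftrightarrow> (\<forall>u. \<not> exceptional \<pi> W u)"
    using leaf_bundle_if_trivial no_exceptional_iff no_exceptional_iff_smooth by blast
  ultimately show ?thesis
    using no_exceptional_iff_no_fixpoint by blast
qed

end
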